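(* Let $\nu$ be a measure on $(0,\infty)$ with $\nu((0,\infty))=\infty$ and $\int_0^\infty (1\wedge x)\,\nu(dx)<\infty$. Let $n\in\mathbb N$ and $\sigma_1,\dots,\sigma_n\in(0,\infty)$. Let $\boldsymbol J=\{J_\ell\}_{\ell\in\mathbb N}$ be a measurable enumeration of the points of a Poisson point process on $(0,\infty)$ with intensity measure $\nu$, and let $\boldsymbol Y_\ell=(Y_{\ell,1},\dots,Y_{\ell,n})$, $\ell\in\mathbb N$, be i.i.d. random vectors, independent of $\boldsymbol J$, such that for each $\ell$ the components $Y_{\ell,1},\dots,Y_{\ell,n}$ are independent and $Y_{\ell,k}$ is $1$-Fréchet with scale parameter $\sigma_k$. Let $\Pi_n$ be the hitting partition of $[n]=\{1,\dots,n\}$ associated with the max-i.d. random vector $$(\zeta_1,\dots,\zeta_n)=\Big(\bigvee_{\ell=1}^\infty J_\ell Y_{\ell,1},\dots,\bigvee_{\ell=1}^\infty J_\ell Y_{\ell,n}\Big).$$ Then $\Pi_n$ is an exchangeable random partition of $[n]$, and it has the same law as the paintbox partition of $[n]$ with random weights $\{P_\ell\}_{\ell\in\mathbb N_0}$ given by $$P_0:=0\quad\text{and}\quad P_\ell:=\frac{J_\ell}{\sum_{\ell'=1}^\infty J_{\ell'}},\qquad \ell\in\mathbb N .$$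
   Context: Notation: $\mathbb N=\{1,2,\dots\}$, $\mathbb N_0=\mathbb N\cup\{0\}$, $\vee=\max$, and $\bigvee$ denotes supremum. A random variable $Y$ is $1$-Fréchet with scale parameter $\sigma>0$ if $\mathbb P(Y\le x)=\exp(-\sigma/x)$ for $x\in(0,\infty)$. The assumptions on $\nu$ ensure that the Poisson process has infinitely many points and that $\sum_{\ell}J_\ell<\infty$ almost surely. Hitting partition: for $k=1,\dots,n$ set $\ell^*(k):=\mathrm{argmax}_{\ell\in\mathbb N}\{J_\ell Y_{\ell,k}\}$, which is uniquely defined with probability one. The hitting partition $\Pi_n$ is the random partition of $[n]$ into the equivalence classes of the relation $i\sim j$ if and only if $\ell^*(i)=\ell^*(j)$, $i,j\in[n]$. A random partition of $[n]$ is exchangeable if its law is invariant under the action of all permutations of $[n]$. Paintbox partition: let $\boldsymbol s=(s_\ell)_{\ell\in\mathbb N_0}$ be (possibly random) non-negative weights with $\sum_{\ell\ge0}s_\ell=1$. Conditionally on $\boldsymbol s$, let $X_1,\dots,X_n$ be i.i.d. $\mathbb N_0$-valued random variables with $\mathbb P(X_1=\ell\mid\boldsymbol s)=s_\ell$, $\ell\in\mathbb N_0$. The paintbox partition of $[n]$ with weights $\boldsymbol s$ is the random partition in which distinct $i,j\in[n]$ are in the same block if and only if $X_i=X_j>0$ (so each $i$ with $X_i=0$ forms a singleton block). *)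

theory Defs
  imports "HOL-Probability.Probability"
begin

text \<open>Sequences and random weights indexed by the positive integers are functions on
  \<^typ>\<open>nat\<close> of which only the values at indices in \<open>{1..}\<close> are used.\<close>

section \<open>Poisson point processes and their enumerations\<close>

definition levy_type_measure :: "real measure \<Rightarrow> bool" where
  "levy_type_measure \<nu> \<longleftrightarrow>
     sets \<nu> = sets (restrict_space borel {0<..}) \<and>
     emeasure \<nu> {0<..} = \<infinity> \<and>
     (\<integral>\<^sup>+ x. ennreal (min 1 x) \<partial>\<nu>) < \<infinity>"

text \<open>A point process is a random measure \<open>N\<close>; \<open>N \<omega> A\<close> is the number of points in \<open>A\<close>.
  In the formula for the Poisson probabilities \<open>0 ^ 0 = 1\<close>, so null sets carry no points
  almost surely.\<close>

definition poisson_point_process ::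
  "'a measure \<Rightarrow> 'b measure \<Rightarrow> ('a \<Rightarrow> 'b measure) \<Rightarrow> bool" where
  "poisson_point_process M \<nu> N \<longleftrightarrow>
     (\<forall>A\<in>sets \<nu>. (\<lambda>\<omega>. emeasure (N \<omega>) A) \<in> borel_measurable M) \<and>
     (\<forall>A\<in>sets \<nu>. emeasure \<nu> A < \<infinity> \<longrightarrow>
        (\<forall>m::nat. measure M {\<omega> \<in> space M. emeasure (N \<omega>) A = of_nat m} =
           measure \<nu> A ^ m / fact m * exp (- measure \<nu> A))) \<and>
     (\<forall>A\<in>sets \<nu>. emeasure \<nu> A = \<infinity> \<longrightarrow> (AE \<omega> in M. emeasure (N \<omega>) A = \<infinity>)) \<and>
     (\<forall>(m::nat) A. (\<forall>i<m. A i \<in> sets \<nu>) \<and> disjoint_family_on A {..<m} \<longrightarrow>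
        prob_space.indep_vars M (\<lambda>_. borel) (\<lambda>i \<omega>. emeasure (N \<omega>) (A i)) {..<m})"

text \<open>The image of counting measure on the indices is the sum of the Dirac measures at the
  \<open>J l \<omega>\<close>, that is, the points are counted with multiplicity.\<close>

definition measurable_enumeration ::
  "'a measure \<Rightarrow> 'b measure \<Rightarrow> (nat \<Rightarrow> 'a \<Rightarrow> 'b) \<Rightarrow> bool" where
  "measurable_enumeration M \<nu> J \<longleftrightarrow>
     (\<forall>l\<in>{1..}. J l \<in> measurable M \<nu>) \<and>
     poisson_point_process M \<nu> (\<lambda>\<omega>. distr (count_space {1..}) \<nu> (\<lambda>l. J l \<omega>))"

section \<open>The random vectors\<close>

definition frechet1 :: "'a measure \<Rightarrow> real \<Rightarrow> ('a \<Rightarrow> real) \<Rightarrow> bool" where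
  "frechet1 M \<sigma> Y \<longleftrightarrow> Y \<in> borel_measurable M \<and>
     (\<forall>x>0. measure M {\<omega> \<in> space M. Y \<omega> \<le> x} = exp (- \<sigma> / x))"

definition row :: "nat \<Rightarrow> (nat \<Rightarrow> nat \<Rightarrow> 'a \<Rightarrow> real) \<Rightarrow> nat \<Rightarrow> 'a \<Rightarrow> nat \<Rightarrow> real" where
  "row n Y l \<omega> = (\<lambda>k\<in>{1..n}. Y l k \<omega>)"

abbreviation row_space :: "nat \<Rightarrow> (nat \<Rightarrow> real) measure" where
  "row_space n \<equiv> Pi\<^sub>M {1..n} (\<lambda>_. borel)"

definition iid_rows :: "'a measure \<Rightarrow> nat \<Rightarrow> (nat \<Rightarrow> nat \<Rightarrow> 'a \<Rightarrow> real) \<Rightarrow> bool" where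
  "iid_rows M n Y \<longleftrightarrow>
     prob_space.indep_vars M (\<lambda>_. row_space n) (row n Y) {1..} \<and>
     (\<forall>l\<in>{1..}. distr M (row_space n) (row n Y l) = distr M (row_space n) (row n Y 1))"

definition points_indep_rows ::
  "'a measure \<Rightarrow> real measure \<Rightarrow> nat \<Rightarrow> (nat \<Rightarrow> 'a \<Rightarrow> real) \<Rightarrow> (nat \<Rightarrow> nat \<Rightarrow> 'a \<Rightarrow> real) \<Rightarrow> bool"
  where
  "points_indep_rows M \<nu> n J Y \<longleftrightarrow>
     prob_space.indep_set M
       (sets (vimage_algebra (space M) (\<lambda>\<omega>. \<lambda>l\<in>{1..}. J l \<omega>) (Pi\<^sub>M {1..} (\<lambda>_. \<nu>))))
       (sets (vimage_algebra (space M) (\<lambda>\<omega>. \<lambda>l\<in>{1..}. row n Y l \<omega>)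
                (Pi\<^sub>M {1..} (\<lambda>_. row_space n))))"

section \<open>Random partitions\<close>

definition partition_space :: "nat \<Rightarrow> nat set set measure" where
  "partition_space n = count_space {P. partition_on {1..n} P}"

definition permute_partition :: "(nat \<Rightarrow> nat) \<Rightarrow> nat set set \<Rightarrow> nat set set" where
  "permute_partition p P = (\<lambda>B. p ` B) ` P"

definition exchangeable_random_partition ::
  "'a measure \<Rightarrow> nat \<Rightarrow> ('a \<Rightarrow> nat set set) \<Rightarrow> bool" where
  "exchangeable_random_partition M n R \<longleftrightarrow>
     R \<in> measurable M (partition_space n) \<and>
     (\<forall>p. p permutes {1..n} \<longrightarrow>
        distr M (partition_space n) (\<lambda>\<omega>. permute_partition p (R \<omega>)) =
        distr M (partition_space n) R)"

text \<open>In the setting of interest the maximiser of \<open>l \<mapsto> J l \<omega> * Y l k \<omega>\<close> exists and is unique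
  almost surely. Taking the least maximiser (and the constant \<open>LEAST l. False\<close> if there
  is none), rather than \<^const>\<open>arg_max\<close>, which is an arbitrary choice, makes the index
  measurable on the exceptional null event as well.\<close>

definition hitting_index ::
  "(nat \<Rightarrow> 'a \<Rightarrow> real) \<Rightarrow> (nat \<Rightarrow> nat \<Rightarrow> 'a \<Rightarrow> real) \<Rightarrow> 'a \<Rightarrow> nat \<Rightarrow> nat" where
  "hitting_index J Y \<omega> k =
     (LEAST l. is_arg_max (\<lambda>l. J l \<omega> * Y l k \<omega>) (\<lambda>l. l \<in> {1..}) l)"

definition hitting_partition ::
  "nat \<Rightarrow> (nat \<Rightarrow> 'a \<Rightarrow> real) \<Rightarrow> (nat \<Rightarrow> nat \<Rightarrow> 'a \<Rightarrow> real) \<Rightarrow> 'a \<Rightarrow> nat set set" where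
  "hitting_partition n J Y \<omega> =
     {1..n} // {(i, j). i \<in> {1..n} \<and> j \<in> {1..n} \<and>
                        hitting_index J Y \<omega> i = hitting_index J Y \<omega> j}"

section \<open>Paintbox partitions\<close>

definition paintbox_partition :: "nat \<Rightarrow> (nat \<Rightarrow> nat) \<Rightarrow> nat set set" where
  "paintbox_partition n x =
     {1..n} // {(i, j). i \<in> {1..n} \<and> j \<in> {1..n} \<and> (i = j \<or> (x i = x j \<and> x i > 0))}"

definition iid_sample :: "nat \<Rightarrow> (nat \<Rightarrow> real) \<Rightarrow> (nat \<Rightarrow> nat) measure" where
  "iid_sample n s = Pi\<^sub>M {1..n} (\<lambda>_. density (count_space UNIV) (\<lambda>l. ennreal (s l)))"

text \<open>The law of the paintbox partition with random weights \<open>s\<close>: given \<open>s \<omega>\<close>, the partition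
  is built from an i.i.d. sample of \<open>s \<omega>\<close>, and the conditional law is averaged over \<open>\<omega>\<close>.
  The weights are meant to be non-negative with sum \<open>1\<close> almost surely and with sum at most
  \<open>1\<close> everywhere, so that the conditional laws form a sub-probability kernel.\<close>

definition paintbox_law ::
  "'a measure \<Rightarrow> nat \<Rightarrow> ('a \<Rightarrow> nat \<Rightarrow> real) \<Rightarrow> nat set set measure" where
  "paintbox_law M n s =
     bind M (\<lambda>\<omega>. distr (iid_sample n (s \<omega>)) (partition_space n) (paintbox_partition n))"

text \<open>On the null event where the \<open>J l \<omega>\<close> are not summable, the denominator is \<open>0\<close> by the
  convention for \<^const>\<open>infsum\<close> and all weights vanish.\<close>

definition normalized_weights :: "(nat \<Rightarrow> 'a \<Rightarrow> real) \<Rightarrow> 'a \<Rightarrow> nat \<Rightarrow> real" where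
  "normalized_weights J \<omega> l =
     (if l = 0 then 0 else J l \<omega> / (\<Sum>\<^sub>\<infinity>l'\<in>{1..}. J l' \<omega>))"

end

theory Submission
  imports Defs
begin

text \<open>
  Given the points, \<open>\<sigma>\<^sub>k / (J\<^sub>l Y\<^sub>l\<^sub>,\<^sub>k)\<close> is exponential with rate \<open>J\<^sub>l\<close>, so \<open>\<ell>\<^sup>*(k)\<close> is the winner
  of a race between independent exponential clocks and equals \<open>l\<close> with probability
  \<open>J\<^sub>l / \<Sum>\<^sub>m J\<^sub>m\<close>, whatever \<open>\<sigma>\<^sub>k\<close> is; the races for different \<open>k\<close> are independent. Hence the
  hitting indices are conditionally an i.i.d. sample from the normalised points, which is the
  sample defining the paintbox. The first moment formula of the Poisson process makes the points
  almost surely summable.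
\<close>
section \<open>Exponential races and Frechet variables\<close>

text \<open>No conditional expectation is formed. Independence makes the joint law of points and
  rows a product measure, and Fubini allows the rows to be averaged while the points stay frozen at
  one summable sequence. The probability that the hitting indices form a given labelling
  \<open>h\<close> is thereby the mean of the product over \<open>k\<close> of the weights at
  \<open>h k\<close>. This product is symmetric in the labels, so reordering the hitting indices
  does not change their joint law; exchangeability comes from this symmetry, since relabelling the
  blocks by \<open>p\<close> amounts to composing the labelling with \<open>inv p\<close>. One
  mismatch remains: the paintbox turns label 0 into singletons and the hitting partition does not.
  As label 0 has weight 0, the two constructions differ only on a null event.\<close>

lemma (in prob_space) exponential_race:
  assumes "0 < a" "0 < b"
    and X: "distributed M lborel X (exponential_density a)"
    and Y: "distributed M lborel Y (exponential_density b)"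
    and ind: "indep_var borel X borel Y"
  shows "prob {\<omega> \<in> space M. X \<omega> < Y \<omega>} = a / (a + b)"
proof -
  have [measurable]: "X \<in> borel_measurable M" "Y \<in> borel_measurable M"
    using X Y by (auto simp: distributed_def)
  interpret dY: prob_space "distr M borel Y" by (rule prob_space_distr) simp
  have "{p \<in> space (borel \<Otimes>\<^sub>M borel). fst p < (snd p :: real)} \<in> sets (borel \<Otimes>\<^sub>M borel)"
    by measurable
  then have [measurable]: "{p. fst p < (snd p :: real)} \<in> sets (borel \<Otimes>\<^sub>M borel)"
    by (simp add: space_pair_measure)
  have [measurable]: "(\<lambda>x. emeasure (distr M borel Y) {x<..}) \<in> borel_measurable borel"
    using dY.measurable_emeasure_Pair[of "{p. fst p < snd p}" borel]
    by (simp add: vimage_def greaterThan_def)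
  have tail: "emeasure (distr M borel Y) {x<..} = ennreal (exp (- x * b))" if "0 \<le> x" for x
    using exponential_distributedD_gt[OF Y that \<open>0 < b\<close>]
    by (simp add: emeasure_distr emeasure_eq_measure vimage_def Int_def conj_commute)
  have "emeasure M {\<omega> \<in> space M. X \<omega> < Y \<omega>} =
      emeasure (distr M (borel \<Otimes>\<^sub>M borel) (\<lambda>\<omega>. (X \<omega>, Y \<omega>))) {p. fst p < snd p}"
    by (subst emeasure_distr) (auto intro!: arg_cong2[where f=emeasure])
  also have "\<dots> = emeasure (distr M borel X \<Otimes>\<^sub>M distr M borel Y) {p. fst p < snd p}"
    using ind by (simp add: indep_var_distribution_eq)
  also have "\<dots> = (\<integral>\<^sup>+x. emeasure (distr M borel Y) (Pair x -` {p. fst p < snd p}) \<partial>distr M borel X)"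
    by (subst dY.emeasure_pair_measure_alt) (auto simp: borel_prod[symmetric])
  also have "\<dots> = (\<integral>\<^sup>+x. emeasure (distr M borel Y) {x<..} \<partial>distr M lborel X)"
    by (auto intro!: nn_integral_cong simp: vimage_def greaterThan_def cong: distr_cong)
  also have "distr M lborel X = density lborel (exponential_density a)"
    using X by (simp add: distributed_def)
  also have "(\<integral>\<^sup>+x. emeasure (distr M borel Y) {x<..} \<partial>density lborel (exponential_density a)) =
      (\<integral>\<^sup>+x. ennreal (exponential_density a x) * emeasure (distr M borel Y) {x<..} \<partial>lborel)"
    by (subst nn_integral_density)  auto
  \<comment> \<open>The density of \<open>X\<close> times the tail of \<open>Y\<close> is, up to the
    factor \<open>a / (a + b)\<close>, the exponential density of rate \<open>a + b\<close>, whose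
    total mass is 1.\<close>
  also have "\<dots> = (\<integral>\<^sup>+x. ennreal (a / (a + b)) * ennreal (exponential_density (a + b) x) \<partial>lborel)"
  proof (intro nn_integral_cong)
    fix x :: real
    show "ennreal (exponential_density a x) * emeasure (distr M borel Y) {x<..} =
      ennreal (a / (a + b)) * ennreal (exponential_density (a + b) x)"
    proof (cases "0 \<le> x")
      case True
      have "a * exp (- x * a) * exp (- x * b) = a * exp (- x * (a + b))"
        by (simp add: distrib_left mult.assoc flip: exp_add)
      also have "\<dots> = a / (a + b) * ((a + b) * exp (- x * (a + b)))"
        using assms(1,2) by simp
      finally show ?thesis using assms(1,2) True
        by (simp add: tail exponential_density_def flip: ennreal_mult)
    qed (simp add: exponential_density_def)
  qed
  also have "\<dots> = ennreal (a / (a + b)) * (\<integral>\<^sup>+x. ennreal (exponential_density (a + b) x) \<partial>lborel)"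
    by (rule nn_integral_cmult) simp
  also have "(\<integral>\<^sup>+x. ennreal (exponential_density (a + b) x) \<partial>lborel) = 1"
    using prob_space.emeasure_space_1[OF prob_space_exponential_density[of "a + b"]] assms(1,2)
    by (simp add: emeasure_density)
  finally show ?thesis using assms(1,2) by (simp add: emeasure_eq_measure)
qed

text \<open>There is no atom at \<open>x\<close>: the distribution function is continuous there, so
  its values just below \<open>x\<close> have the same limit. The strict form is wanted because
  taking reciprocals reverses the inequality in \<open>frechet1_exponential\<close>.\<close>

lemma (in prob_space) frechet1_prob_less:
  assumes X: "frechet1 M \<sigma> X" and "0 < \<sigma>" "0 < x"
  shows "prob {\<omega> \<in> space M. X \<omega> < x} = exp (- \<sigma> / x)"
proof (rule antisym)
  have [measurable]: "X \<in> borel_measurable M"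
    and le: "\<And>x. 0 < x \<Longrightarrow> prob {\<omega> \<in> space M. X \<omega> \<le> x} = exp (- \<sigma> / x)"
    using X by (auto simp: frechet1_def)
  show "prob {\<omega> \<in> space M. X \<omega> < x} \<le> exp (- \<sigma> / x)"
    unfolding le[OF \<open>0 < x\<close>, symmetric] by (rule finite_measure_mono) auto
  show "exp (- \<sigma> / x) \<le> prob {\<omega> \<in> space M. X \<omega> < x}"
  proof (rule tendsto_upperbound)
    show "((\<lambda>y. exp (- \<sigma> / y)) \<longlongrightarrow> exp (- \<sigma> / x)) (at_left x)"
      using \<open>0 < x\<close> by (intro tendsto_intros) auto
    show "\<forall>\<^sub>F y in at_left x. exp (- \<sigma> / y) \<le> prob {\<omega> \<in> space M. X \<omega> < x}"
      using eventually_at_left_real[OF \<open>0 < x\<close>]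
    proof eventually_elim
      case (elim y)
      then show ?case
        using le[of y, symmetric] by (auto intro!: finite_measure_mono)
    qed
  qed simp
qed

text \<open>\<open>frechet1\<close> prescribes the distribution function at positive arguments only;
  letting the argument decrease to 0 shows that no mass sits on the nonpositive half-line.\<close>

lemma (in prob_space) frechet1_AE_pos:
  assumes X: "frechet1 M \<sigma> X" and "0 < \<sigma>"
  shows "AE \<omega> in M. 0 < X \<omega>"
proof -
  have [measurable]: "X \<in> borel_measurable M"
    and le: "\<And>x. 0 < x \<Longrightarrow> prob {\<omega> \<in> space M. X \<omega> \<le> x} = exp (- \<sigma> / x)"
    using X by (auto simp: frechet1_def)
  have "prob {\<omega> \<in> space M. X \<omega> \<le> 0} \<le> 0"
  proof (rule tendsto_lowerbound)
    have "filterlim (\<lambda>y. \<sigma> / y) at_top (at_right 0)"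
      using \<open>0 < \<sigma>\<close> unfolding divide_inverse
      by (intro filterlim_tendsto_pos_mult_at_top[OF tendsto_const] filterlim_inverse_at_top_right)
    then show "((\<lambda>y. exp (- \<sigma> / y)) \<longlongrightarrow> 0) (at_right 0)"
      by (auto intro!: filterlim_compose[OF exp_at_bot] simp: filterlim_uminus_at_bot)
    show "\<forall>\<^sub>F y in at_right 0. prob {\<omega> \<in> space M. X \<omega> \<le> 0} \<le> exp (- \<sigma> / y)"
      using eventually_at_right_less[of "0::real"]
    proof eventually_elim
      case (elim y)
      then show ?case
        using le[of y, symmetric] by (auto intro!: finite_measure_mono)
    qed
  qed simp
  then have "AE \<omega> in M. \<not> X \<omega> \<le> 0"
    by (subst (asm) measure_le_0_iff) (auto intro!: AE_I'[of "{\<omega> \<in> space M. X \<omega> \<le> 0}"] simp: emeasure_eq_measure)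
  then show ?thesis by (simp add: not_le)
qed

lemma (in prob_space) frechet1_exponential:
  assumes X: "frechet1 M \<sigma> X" and "0 < \<sigma>" "0 < c"
  shows "distributed M lborel (\<lambda>\<omega>. \<sigma> / (c * X \<omega>)) (exponential_density c)"
proof -
  have X_meas [measurable]: "X \<in> borel_measurable M"
    using X by (auto simp: frechet1_def)
  show ?thesis
    unfolding exponential_distributed_iff[OF \<open>0 < c\<close>]
  proof (intro conjI allI impI)
    fix a :: real assume "0 \<le> a"
    show "prob {\<omega> \<in> space M. \<sigma> / (c * X \<omega>) \<le> a} = 1 - exp (- a * c)"
    \<comment> \<open>The threshold \<open>\<sigma> / (c * a)\<close> is meaningful only for
      \<open>a > 0\<close>. At \<open>a = 0\<close> the event is null because \<open>X\<close> is
      almost surely positive.\<close>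
    proof (cases "a = 0")
      case True
      have "prob {\<omega> \<in> space M. \<sigma> / (c * X \<omega>) \<le> a} = 0"
        using frechet1_AE_pos[OF assms(1,2)] assms(2,3) True
        by (subst prob_eq_0) (auto simp: divide_le_0_iff mult_le_0_iff)
      then show ?thesis using True by simp
    next
      case False
      then have "0 < a" using \<open>0 \<le> a\<close> by simp
      have "prob {\<omega> \<in> space M. \<sigma> / (c * X \<omega>) \<le> a} = prob (space M - {\<omega> \<in> space M. X \<omega> < \<sigma> / (c * a)})"
        using frechet1_AE_pos[OF assms(1,2)] assms(2,3) \<open>0 < a\<close>
        by (intro finite_measure_eq_AE) (auto simp: field_simps)
      also have "\<dots> = 1 - prob {\<omega> \<in> space M. X \<omega> < \<sigma> / (c * a)}"
        by (rule prob_compl) measurable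
      also have "\<dots> = 1 - exp (- a * c)"
        using frechet1_prob_less[OF assms(1,2), of "\<sigma> / (c * a)"] assms(2,3) \<open>0 < a\<close>
        by (simp add: mult.commute)
      finally show ?thesis .
    qed
  qed simp
qed

section \<open>The first maximiser of a Frechet sequence\<close>

text \<open>The selection rule of \<open>hitting_index\<close> for a single real sequence. Freed
  from the outcome, it can be applied to points and Frechet variables taken at two different
  outcomes.\<close>

definition first_argmax :: "(nat \<Rightarrow> real) \<Rightarrow> nat" where
  "first_argmax f = (LEAST l. is_arg_max f (\<lambda>l. l \<in> {1..}) l)"

lemma first_argmax_eqI:
  assumes "1 \<le> l" "\<And>m. 1 \<le> m \<Longrightarrow> m \<noteq> l \<Longrightarrow> f m < f l"
  shows "first_argmax f = l"
proof -
  have "is_arg_max f (\<lambda>l. l \<in> {1..}) = (\<lambda>m. m = l)"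
    using assms by (force simp: is_arg_max_def)
  then show ?thesis unfolding first_argmax_def by (metis (full_types) LeastI)
qed

lemma first_argmax_cong:
  assumes "\<And>l. 1 \<le> l \<Longrightarrow> f l = g l"
  shows "first_argmax f = first_argmax g"
proof -
  have "is_arg_max f (\<lambda>l. l \<in> {1..}) = is_arg_max g (\<lambda>l. l \<in> {1..})"
    using assms by (auto simp: is_arg_max_def fun_eq_iff)
  then show ?thesis by (simp add: first_argmax_def)
qed

lemma measurable_first_argmax:
  assumes X: "\<And>l. 1 \<le> l \<Longrightarrow> X l \<in> borel_measurable M"
  shows "(\<lambda>\<omega>. first_argmax (\<lambda>l. X l \<omega>)) \<in> measurable M (count_space UNIV)"
proof -
  \<comment> \<open>Measurability is given at positive indices only. The term at 0 does not
    influence \<open>first_argmax\<close>, so replacing it by 0 makes every term measurable.\<close>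
  define Z where "Z l = (if 1 \<le> l then X l else (\<lambda>_. 0))" for l
  have [measurable]: "Z l \<in> borel_measurable M" for l
    using X by (simp add: Z_def)
  have "first_argmax (\<lambda>l. X l \<omega>) = first_argmax (\<lambda>l. Z l \<omega>)" for \<omega>
    by (rule first_argmax_cong) (simp add: Z_def)
  then show ?thesis
    unfolding first_argmax_def is_arg_max_def by simp
qed

text \<open>In terms of the clocks \<open>T i\<close>, the largest product is the earliest clock.
  The minimum of the rival clocks is exponential with the sum of their rates, which leaves a race of
  two clocks; \<open>I \<noteq> {l}\<close> ensures that there is a rival.\<close>

lemma (in prob_space) prob_finite_race:
  assumes ind: "indep_vars (\<lambda>_. borel) X I"
    and I: "finite I" "l \<in> I" "I \<noteq> {l}"
    and X: "\<And>i. i \<in> I \<Longrightarrow> frechet1 M \<sigma> (X i)" "0 < \<sigma>"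
    and j: "\<And>i. i \<in> I \<Longrightarrow> 0 < j i"
  shows "prob {\<omega> \<in> space M. \<forall>m\<in>I - {l}. j m * X m \<omega> < j l * X l \<omega>} = j l / sum j I"
proof -
  define T where "T i \<omega> = \<sigma> / (j i * X i \<omega>)" for i \<omega>
  have [measurable]: "X i \<in> borel_measurable M" if "i \<in> I" for i
    using X(1)[OF that] by (auto simp: frechet1_def)
  have expT: "distributed M lborel (T i) (exponential_density (j i))" if "i \<in> I" for i
    unfolding T_def using X(1)[OF that] X(2) j[OF that] by (rule frechet1_exponential)
  have indT: "indep_vars (\<lambda>_. borel) T I"
    unfolding T_def by (rule indep_vars_compose2[OF ind]) measurable
  have "AE \<omega> in M. \<forall>i\<in>I. 0 < X i \<omega>"
    using I X by (intro AE_finite_allI frechet1_AE_pos) auto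
  moreover have "(\<forall>m\<in>I - {l}. j m * X m \<omega> < j l * X l \<omega>) \<longleftrightarrow> T l \<omega> < Min ((\<lambda>i. T i \<omega>) ` (I - {l}))"
    if "\<forall>i\<in>I. 0 < X i \<omega>" for \<omega>
    using that I X(2) j by (subst Min_gr_iff) (auto simp: T_def divide_less_eq_1 frac_less2 field_simps)
  ultimately have "prob {\<omega> \<in> space M. \<forall>m\<in>I - {l}. j m * X m \<omega> < j l * X l \<omega>} =
      prob {\<omega> \<in> space M. T l \<omega> < Min ((\<lambda>i. T i \<omega>) ` (I - {l}))}"
    using I by (intro finite_measure_eq_AE) (auto elim!: eventually_mono simp: T_def)
  also have "\<dots> = j l / (j l + sum j (I - {l}))"
  proof (rule exponential_race)
    show "distributed M lborel (\<lambda>\<omega>. Min ((\<lambda>i. T i \<omega>) ` (I - {l}))) (exponential_density (sum j (I - {l})))"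
      using I j expT by (intro exponential_distributed_Min indep_vars_subset[OF indT]) auto
    show "indep_var borel (T l) borel (\<lambda>\<omega>. Min ((\<lambda>i. T i \<omega>) ` (I - {l})))"
      using I by (intro indep_vars_Min indep_vars_subset[OF indT]) auto
    show "0 < sum j (I - {l})"
      using I j by (intro sum_pos) auto
  qed (use I j expT in auto)
  also have "j l + sum j (I - {l}) = sum j I"
    using I by (simp add: sum.remove)
  finally show ?thesis .
qed

lemma atLeast_1_eq_range_Suc: "{1..} = range Suc"
  by (auto simp: image_iff Suc_le_eq gr0_conv_Suc)

lemma has_sum_Suc_iff: "(f has_sum S) {1..} \<longleftrightarrow> ((\<lambda>l. f (Suc l)) has_sum S) UNIV"
  by (subst atLeast_1_eq_range_Suc) (simp add: has_sum_reindex comp_def)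

lemma sums_Suc_infsum:
  fixes f :: "nat \<Rightarrow> real"
  assumes "f summable_on {1..}"
  shows "(\<lambda>l. f (Suc l)) sums (\<Sum>\<^sub>\<infinity>l\<in>{1..}. f l)"
  using has_sum_infsum[OF assms] unfolding has_sum_Suc_iff by (rule has_sum_imp_sums)

text \<open>Winning all finite races gives \<open>\<ge>\<close>; equality follows because both sides sum to \<open>1\<close> over \<open>l\<close>.\<close>

lemma (in prob_space) prob_first_argmax:
  assumes ind: "indep_vars (\<lambda>_. borel) X {1..}"
    and X: "\<And>i. 1 \<le> i \<Longrightarrow> frechet1 M \<sigma> (X i)" "0 < \<sigma>"
    and j: "\<And>i. 1 \<le> i \<Longrightarrow> 0 < j i" "j summable_on {1..}"
  shows "prob {\<omega> \<in> space M. first_argmax (\<lambda>l. j l * X l \<omega>) = l} =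
    (if l = 0 then 0 else j l / (\<Sum>\<^sub>\<infinity>l\<in>{1..}. j l))"
proof -
  define S where "S = (\<Sum>\<^sub>\<infinity>l\<in>{1..}. j l)"
  define p where "p l = (if l = 0 then 0 else j l / S)" for l
  define H where "H l = {\<omega> \<in> space M. first_argmax (\<lambda>l. j l * X l \<omega>) = l}" for l
  define E where "E l N = {\<omega> \<in> space M. \<forall>m\<in>{1..N} - {l}. j m * X m \<omega> < j l * X l \<omega>}" for l N
  have X_meas [measurable]: "X i \<in> borel_measurable M" if "1 \<le> i" for i
    using X(1)[OF that] by (auto simp: frechet1_def)
  have H_events: "H l \<in> events" for l
  proof -
    have "(\<lambda>\<omega>. first_argmax (\<lambda>l. j l * X l \<omega>)) \<in> measurable M (count_space UNIV)"
      by (rule measurable_first_argmax) measurable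
    then show ?thesis unfolding H_def by measurable
  qed
  have sums_S: "(\<lambda>l. j (Suc l)) sums S"
    unfolding S_def using j(2) by (rule sums_Suc_infsum)
  have "0 < S"
    using sums_S j(1) suminf_pos[of "\<lambda>l. j (Suc l)"] by (auto simp: sums_iff)
  have "(\<lambda>l. p (Suc l)) sums 1"
    using sums_divide[OF sums_S, of S] \<open>0 < S\<close> by (simp add: p_def)
  then have p_sums: "p sums 1"
    by (subst (asm) sums_Suc_iff) (simp add: p_def)
  have p_le: "p l \<le> prob (H l)" for l
  proof (cases "l = 0")
    case False
    have "(\<lambda>N. prob (E l N)) \<longlonglongrightarrow> j l / S"
    proof (rule Lim_transform_eventually)
      show "(\<lambda>N. j l / sum j {1..N}) \<longlonglongrightarrow> j l / S"
        using sums_S \<open>0 < S\<close> by (intro tendsto_intros) (auto simp: sums_def sum.atLeast1_atMost_eq)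
      show "\<forall>\<^sub>F N in sequentially. j l / sum j {1..N} = prob (E l N)"
        \<comment> \<open>For \<open>N > l\<close> the index \<open>l\<close> takes part in the race
          up to \<open>N\<close> and has at least one rival.\<close>
        using eventually_gt_at_top[of l]
      proof eventually_elim
        case (elim N)
        have "N \<in> {1..N}" "N \<notin> {l}" using elim by auto
        then have "{1..N} \<noteq> {l}" by blast
        then show ?case unfolding E_def using elim False X j
          by (intro prob_finite_race[symmetric, where \<sigma>=\<sigma>] indep_vars_subset[OF ind]) auto
      qed
    qed
    moreover have "(\<lambda>N. prob (E l N)) \<longlonglongrightarrow> prob (\<Inter>N. E l N)"
      using False by (intro finite_Lim_measure_decseq) (auto simp: E_def decseq_def)
    ultimately have "p l = prob (\<Inter>N. E l N)"
      using False by (simp add: p_def LIMSEQ_unique)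
    also have "\<dots> \<le> prob (H l)"
    proof (rule finite_measure_mono[OF _ H_events])
      show "(\<Inter>N. E l N) \<subseteq> H l"
        using False by (fastforce simp: E_def H_def intro!: first_argmax_eqI)
    qed
    finally show ?thesis .
  qed (simp add: p_def)
  \<comment> \<open>\<open>first_argmax\<close> is total, so outcomes without a maximiser also lie
    in some \<open>H l\<close>, and the probabilities sum to exactly 1. As the strict wins already
    account for all of this mass, ties and missing maximisers have probability 0.\<close>
  have "(\<lambda>l. prob (H l)) sums prob (\<Union>l. H l)"
    using H_events by (intro finite_measure_UNION) (auto simp: H_def disjoint_family_on_def)
  also have "(\<Union>l. H l) = space M" by (auto simp: H_def)
  finally have "(\<lambda>l. prob (H l) - p l) sums 0"
    using sums_diff[OF _ p_sums, of "\<lambda>l. prob (H l)" 1] by (simp add: prob_space)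
  then have "prob (H l) - p l = 0"
    using p_le suminf_eq_zero_iff[of "\<lambda>l. prob (H l) - p l"] by (simp add: sums_iff)
  then show ?thesis by (simp add: H_def p_def S_def)
qed

section \<open>Summability of the points\<close>

lemma poisson_mean:
  fixes r :: real assumes "0 \<le> r"
  shows "(\<Sum>m. ennreal m * ennreal (r ^ m / fact m * exp (- r))) = ennreal r"
proof -
  have "(\<lambda>m. r * exp (- r) * (r ^ m /\<^sub>R fact m)) sums (r * exp (- r) * exp r)"
    by (intro sums_mult exp_converges)
  moreover have "real (Suc m) * (r ^ Suc m / fact (Suc m) * exp (- r)) = r * exp (- r) * (r ^ m /\<^sub>R fact m)" for m
    by (simp add: divide_simps)
  moreover have "r * exp (- r) * exp r = r"
    by (simp add: mult.assoc flip: exp_add)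
  ultimately have "(\<lambda>m. real (Suc m) * (r ^ Suc m / fact (Suc m) * exp (- r))) sums r"
    by (simp only:)
  then have "(\<lambda>m. real m * (r ^ m / fact m * exp (- r))) sums r"
    by (subst (asm) sums_Suc_iff) simp
  then have "(\<lambda>m. ennreal (real m * (r ^ m / fact m * exp (- r)))) sums ennreal r"
    using assms by (subst sums_ennreal) auto
  moreover have "ennreal m * ennreal (r ^ m / fact m * exp (- r)) = ennreal (real m * (r ^ m / fact m * exp (- r)))" for m
    using assms by (intro ennreal_mult[symmetric]) auto
  ultimately show ?thesis
    by (simp only: sums_iff)
qed

text \<open>\<open>N\<close> has extended nonnegative values and could a priori be infinite or
  fractional. The Poisson probabilities sum to 1, so it is almost surely a natural number and its
  mean is a sum over its level sets.\<close>

lemma (in prob_space) nn_integral_poisson: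
  assumes [measurable]: "N \<in> borel_measurable M" and "0 \<le> r"
    and N: "\<And>m::nat. prob {\<omega> \<in> space M. N \<omega> = of_nat m} = r ^ m / fact m * exp (- r)"
  shows "(\<integral>\<^sup>+\<omega>. N \<omega> \<partial>M) = ennreal r"
proof -
  define A where "A m = {\<omega> \<in> space M. N \<omega> = (of_nat m :: ennreal)}" for m
  have [measurable]: "A m \<in> events" for m by (simp add: A_def)
  have prob_A: "prob (A m) = r ^ m / fact m * exp (- r)" for m
    by (simp add: A_def N)
  have disj: "disjoint_family A" by (auto simp: A_def disjoint_family_on_def)
  have "(\<lambda>m. prob (A m)) sums prob (\<Union>m. A m)"
    by (rule finite_measure_UNION) (use disj in auto)
  moreover have "(\<lambda>m. prob (A m)) sums 1"
    using sums_mult[OF exp_converges[of r], of "exp (- r)"]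
    by (simp add: prob_A field_simps flip: exp_add)
  ultimately have "prob (\<Union>m. A m) = 1" by (rule sums_unique2)
  then have "AE \<omega> in M. \<omega> \<in> (\<Union>m. A m)" by (rule prob_eq_1[THEN iffD1, rotated]) auto
  then have "(\<integral>\<^sup>+\<omega>. N \<omega> \<partial>M) = (\<integral>\<^sup>+\<omega>. (\<Sum>m. of_nat m * indicator (A m) \<omega>) \<partial>M)"
  proof (intro nn_integral_cong_AE, elim eventually_mono)
    fix \<omega> assume "\<omega> \<in> (\<Union>m. A m)"
    then obtain m where m: "\<omega> \<in> A m" by auto
    then have "of_nat i * indicator (A i) \<omega> = (if i = m then of_nat m else 0 :: ennreal)" for i
      using disj by (auto simp: disjoint_family_on_def indicator_def)
    then have "(\<Sum>i. of_nat i * indicator (A i) \<omega>) = (of_nat m :: ennreal)"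
      by (simp add: sums_unique[OF sums_single, symmetric])
    then show "N \<omega> = (\<Sum>i. of_nat i * indicator (A i) \<omega>)"
      using m by (simp add: A_def)
  qed
  also have "\<dots> = (\<Sum>m. of_nat m * emeasure M (A m))"
    by (subst nn_integral_suminf) (auto simp: nn_integral_cmult_indicator)
  also have "\<dots> = ennreal r"
    using poisson_mean[OF \<open>0 \<le> r\<close>] by (simp add: emeasure_eq_measure prob_A ennreal_of_nat_eq_real_of_nat)
  finally show ?thesis .
qed

text \<open>The left side is the integral of \<open>f\<close> against the mean measure
  \<open>\<mu>\<close> of the process, realised as the image of counting measure times
  \<open>M\<close>. Equality of \<open>\<mu>\<close> and \<open>\<nu>\<close> is checked on each
  measurable set, where it says that the expected number of points is the intensity.\<close>

lemma (in prob_space) campbell: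
  assumes enum: "measurable_enumeration M \<nu> J" and f [measurable]: "f \<in> borel_measurable \<nu>"
  shows "(\<integral>\<^sup>+\<omega>. (\<Sum>l. f (J (Suc l) \<omega>)) \<partial>M) = (\<integral>\<^sup>+x. f x \<partial>\<nu>)"
proof -
  have [measurable]: "J (Suc l) \<in> measurable M \<nu>" for l
    using enum by (auto simp: measurable_enumeration_def)
  define N where "N \<omega> = distr (count_space {1..}) \<nu> (\<lambda>l. J l \<omega>)" for \<omega>
  have ppp: "poisson_point_process M \<nu> N"
    using enum unfolding measurable_enumeration_def N_def by blast
  define \<mu> where "\<mu> = distr (count_space UNIV \<Otimes>\<^sub>M M) \<nu> (\<lambda>(l, \<omega>). J (Suc l) \<omega>)"
  have int_\<mu>: "(\<integral>\<^sup>+x. g x \<partial>\<mu>) = (\<integral>\<^sup>+\<omega>. (\<Sum>l. g (J (Suc l) \<omega>)) \<partial>M)"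
    if [measurable]: "g \<in> borel_measurable \<nu>" for g
    by (simp add: \<mu>_def nn_integral_distr nn_integral_fst[symmetric] nn_integral_count_space_nat
      nn_integral_suminf)
  have N_A: "emeasure (N \<omega>) A = (\<Sum>l. indicator A (J (Suc l) \<omega>))"
    if "\<omega> \<in> space M" "A \<in> sets \<nu>" for A \<omega>
  proof -
    have "emeasure (N \<omega>) A = (\<integral>\<^sup>+x. indicator A x \<partial>N \<omega>)"
      using that by (simp add: N_def)
    also have "\<dots> = (\<integral>\<^sup>+l. indicator A (J l \<omega>) \<partial>count_space {1..})"
      unfolding N_def using that enum
      by (subst nn_integral_distr) (auto simp: measurable_enumeration_def intro: measurable_space)
    also note atLeast_1_eq_range_Suc
    also have "(\<integral>\<^sup>+l. indicator A (J l \<omega>) \<partial>count_space (range Suc)) =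
        (\<integral>\<^sup>+l. indicator A (J (Suc l) \<omega>) \<partial>count_space UNIV)"
      by (rule nn_integral_bij_count_space[symmetric]) (simp add: bij_betw_def)
    finally show ?thesis by (simp add: nn_integral_count_space_nat)
  qed
  have "\<mu> = \<nu>"
  proof (rule measure_eqI)
    show "sets \<mu> = sets \<nu>" by (simp add: \<mu>_def)
    fix A assume "A \<in> sets \<mu>"
    then have A [measurable]: "A \<in> sets \<nu>" by (simp add: \<mu>_def)
    have NA_meas [measurable]: "(\<lambda>\<omega>. emeasure (N \<omega>) A) \<in> borel_measurable M"
      using ppp A by (auto simp: poisson_point_process_def)
    have "emeasure \<mu> A = (\<integral>\<^sup>+x. indicator A x \<partial>\<mu>)"
      using A by (simp add: \<mu>_def)
    also have "\<dots> = (\<integral>\<^sup>+\<omega>. emeasure (N \<omega>) A \<partial>M)"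
      using A by (auto simp: int_\<mu> N_A intro!: nn_integral_cong)
    also have "\<dots> = emeasure \<nu> A"
    proof (cases "emeasure \<nu> A = \<infinity>")
      case True
      then have "AE \<omega> in M. emeasure (N \<omega>) A = \<infinity>"
        using ppp A by (auto simp: poisson_point_process_def)
      then have "(\<integral>\<^sup>+\<omega>. emeasure (N \<omega>) A \<partial>M) = (\<integral>\<^sup>+\<omega>. \<infinity> \<partial>M)"
        by (rule nn_integral_cong_AE)
      then show ?thesis using True by (simp add: emeasure_space_1)
    next
      case False
      then have "(\<integral>\<^sup>+\<omega>. emeasure (N \<omega>) A \<partial>M) = ennreal (measure \<nu> A)"
        using ppp A by (intro nn_integral_poisson) (auto simp: poisson_point_process_def less_top)
      then show ?thesis using False by (simp add: emeasure_eq_ennreal_measure)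
    qed
    finally show "emeasure \<mu> A = emeasure \<nu> A" .
  qed
  then show ?thesis using int_\<mu>[OF f] by simp
qed

lemma (in prob_space) points_pos:
  assumes "levy_type_measure \<nu>" "measurable_enumeration M \<nu> J" "1 \<le> l" "\<omega> \<in> space M"
  shows "0 < J l \<omega>"
proof -
  have "space \<nu> = {0<..}"
    using assms(1) sets_eq_imp_space_eq[of \<nu> "restrict_space borel {0<..}"]
    by (simp add: levy_type_measure_def space_restrict_space)
  then show ?thesis
    using assms(2-) measurable_space[of "J l" M \<nu> \<omega>] by (auto simp: measurable_enumeration_def)
qed

text \<open>\<open>campbell\<close> is applied to \<open>min 1 x\<close>, whose integral against
  \<open>\<nu>\<close> is finite. A convergent truncated sum has terms tending to 0, so only
  finitely many points reach 1 and the truncation can be removed.\<close>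

lemma (in prob_space) AE_points_summable:
  assumes levy: "levy_type_measure \<nu>" and enum: "measurable_enumeration M \<nu> J"
  shows "AE \<omega> in M. (\<lambda>l. J l \<omega>) summable_on {1..}"
proof -
  have "sets \<nu> = sets (restrict_space borel {0<..})"
    using levy by (simp add: levy_type_measure_def)
  then have [measurable]: "(\<lambda>x. x) \<in> borel_measurable \<nu>"
    by (subst measurable_cong_sets[OF _ refl]) (auto intro: measurable_restrict_space1)
  have [measurable]: "J (Suc l) \<in> measurable M \<nu>" for l
    using enum by (auto simp: measurable_enumeration_def)
  have "(\<integral>\<^sup>+\<omega>. (\<Sum>l. ennreal (min 1 (J (Suc l) \<omega>))) \<partial>M) < \<infinity>"
    using levy by (subst campbell[OF enum]) (auto simp: levy_type_measure_def)
  then have "AE \<omega> in M. (\<Sum>l. ennreal (min 1 (J (Suc l) \<omega>))) \<noteq> \<infinity>"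
    by (intro nn_integral_noteq_infinite) auto
  then show ?thesis
  proof (rule AE_mp, intro AE_I2 impI)
    fix \<omega> assume \<omega>: "\<omega> \<in> space M" and fin: "(\<Sum>l. ennreal (min 1 (J (Suc l) \<omega>))) \<noteq> \<infinity>"
    have pos: "0 < J (Suc l) \<omega>" for l
      using points_pos[OF levy enum _ \<omega>] by simp
    have sm: "summable (\<lambda>l. min 1 (J (Suc l) \<omega>))"
      using fin pos by (intro summable_suminf_not_top) (auto simp: less_imp_le)
    then have "(\<lambda>l. min 1 (J (Suc l) \<omega>)) \<longlonglongrightarrow> 0" by (rule summable_LIMSEQ_zero)
    then have "\<forall>\<^sub>F l in sequentially. min 1 (J (Suc l) \<omega>) < 1"
      by (rule order_tendstoD) simp
    then have "\<forall>\<^sub>F l in sequentially. min 1 (J (Suc l) \<omega>) = J (Suc l) \<omega>"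
      by (rule eventually_mono) (auto simp: min_def split: if_splits)
    then have "summable (\<lambda>l. J (Suc l) \<omega>)"
      using sm by (subst (asm) summable_cong) auto
    then have "(\<lambda>l. J (Suc l) \<omega>) summable_on UNIV"
      using pos by (subst summable_on_UNIV_nonneg_real_iff) (auto simp: less_imp_le)
    then show "(\<lambda>l. J l \<omega>) summable_on {1..}"
      unfolding summable_on_def has_sum_Suc_iff .
  qed
qed

section \<open>Independence of the columns\<close>

text \<open>Independence between rows and within each row gives independence of the whole array. A
  finite set \<open>F\<close> of positions is sorted by rows: the constraints on row
  \<open>l\<close> form the cylinder \<open>C l\<close>, so the probability factors over the rows
  and then inside each row.\<close>

lemma (in prob_space) indep_vars_nested:
  assumes rows: "indep_vars (\<lambda>_. Pi\<^sub>M K N) R I"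
    and cols: "\<And>l. l \<in> I \<Longrightarrow> indep_vars N (\<lambda>k \<omega>. R l \<omega> k) K"
    and "finite K"
  shows "indep_vars (\<lambda>(l, k). N k) (\<lambda>(l, k) \<omega>. R l \<omega> k) (I \<times> K)"
  unfolding indep_vars_def2
proof (intro conjI ballI indep_setsI)
  fix p assume "p \<in> I \<times> K"
  then show "random_variable (case p of (l, k) \<Rightarrow> N k) (case p of (l, k) \<Rightarrow> \<lambda>\<omega>. R l \<omega> k)"
    using cols by (auto simp: indep_vars_def)
next
  fix p assume p: "p \<in> I \<times> K"
  then show "{(case p of (l, k) \<Rightarrow> \<lambda>\<omega>. R l \<omega> k) -` A \<inter> space M |A. A \<in> sets (case p of (l, k) \<Rightarrow> N k)} \<subseteq> events"
    using cols by (auto simp: indep_vars_def intro: measurable_sets)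
next
  fix A F assume F: "F \<noteq> {}" "F \<subseteq> I \<times> K" "finite F"
    and A: "\<forall>p\<in>F. A p \<in> {(case p of (l, k) \<Rightarrow> \<lambda>\<omega>. R l \<omega> k) -` B \<inter> space M |B. B \<in> sets (case p of (l, k) \<Rightarrow> N k)}"
  have "\<forall>p\<in>F. \<exists>B. B \<in> sets (N (snd p)) \<and> A p = {\<omega> \<in> space M. R (fst p) \<omega> (snd p) \<in> B}"
    using A by (fastforce simp: vimage_def Int_def conj_commute)
  then obtain B where B: "\<And>p. p \<in> F \<Longrightarrow> B p \<in> sets (N (snd p))"
      "\<And>p. p \<in> F \<Longrightarrow> A p = {\<omega> \<in> space M. R (fst p) \<omega> (snd p) \<in> B p}"
    by metis
  define L where "L = fst ` F"
  define G where "G l = {k. (l, k) \<in> F}" for l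
  have G: "finite (G l)" "G l \<subseteq> K" "l \<in> L \<Longrightarrow> G l \<noteq> {}" for l
    using F \<open>finite K\<close> by (auto simp: G_def L_def intro: finite_subset)
  have L: "finite L" "L \<subseteq> I" "L \<noteq> {}"
    using F by (auto simp: L_def)
  have F_eq: "F = Sigma L G" by (force simp: L_def G_def)
  define C where "C l = {r \<in> space (Pi\<^sub>M K N). \<forall>k\<in>G l. r k \<in> B (l, k)}" for l
  have C: "C l \<in> sets (Pi\<^sub>M K N)" if "l \<in> L" for l
    unfolding C_def
  proof (rule sets.sets_Collect_finite_All)
    fix k assume "k \<in> G l"
    then show "{r \<in> space (Pi\<^sub>M K N). r k \<in> B (l, k)} \<in> sets (Pi\<^sub>M K N)"
      using B(1)[of "(l, k)"] G(2)[of l] that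
      by (intro sets_Collect_single) (auto simp: F_eq)
  qed (rule G)
  have R: "R l \<omega> \<in> space (Pi\<^sub>M K N)" if "l \<in> L" "\<omega> \<in> space M" for l \<omega>
    using rows that L(2) by (auto simp: indep_vars_def dest!: bspec[where x=l] intro: measurable_space)
  have "(\<Inter>p\<in>F. A p) = (\<Inter>l\<in>L. R l -` C l \<inter> space M)"
    using R L(3) by (auto simp: B(2) F_eq C_def) (use G(3) in blast)+
  then have "prob (\<Inter>p\<in>F. A p) = (\<Prod>l\<in>L. prob (R l -` C l \<inter> space M))"
    using indep_varsD[OF rows L(3,1,2), of C] C by simp
  also have "\<dots> = (\<Prod>l\<in>L. \<Prod>k\<in>G l. prob (A (l, k)))"
  proof (rule prod.cong[OF refl])
    fix l assume l: "l \<in> L"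
    have *: "(\<lambda>\<omega>. R l \<omega> k) -` B (l, k) \<inter> space M = A (l, k)" if "k \<in> G l" for k
      using that l by (auto simp: B(2) F_eq)
    have "R l -` C l \<inter> space M = (\<Inter>k\<in>G l. (\<lambda>\<omega>. R l \<omega> k) -` B (l, k) \<inter> space M)"
      using R l G(3)[OF l] by (auto simp: C_def)
    also have "prob \<dots> = (\<Prod>k\<in>G l. prob ((\<lambda>\<omega>. R l \<omega> k) -` B (l, k) \<inter> space M))"
      using l L(2) B(1) by (intro indep_varsD[OF cols] G) (auto simp: F_eq)
    finally show "prob (R l -` C l \<inter> space M) = (\<Prod>k\<in>G l. prob (A (l, k)))"
      by (simp add: *)
  qed
  also have "\<dots> = (\<Prod>p\<in>F. prob (A p))"
    unfolding F_eq using L(1) G(1) by (simp add: prod.Sigma)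
  finally show "prob (\<Inter>p\<in>F. A p) = (\<Prod>p\<in>F. prob (A p))" .
qed

text \<open>With \<open>j\<close> fixed, the winner for \<open>k\<close> depends on column
  \<open>k\<close> alone. Regrouping the independent array by columns makes the winners independent,
  and each of them has the law from \<open>prob_first_argmax\<close>, in which the scale no longer
  appears.\<close>

lemma (in prob_space) prob_first_argmax_columns:
  fixes R :: "nat \<Rightarrow> 'a \<Rightarrow> 'k \<Rightarrow> real"
  assumes rows: "indep_vars (\<lambda>_. Pi\<^sub>M K (\<lambda>_. borel)) R {1..}"
    and cols: "\<And>l. 1 \<le> l \<Longrightarrow> indep_vars (\<lambda>_. borel) (\<lambda>k \<omega>. R l \<omega> k) K"
    and "finite K"
    and R: "\<And>l k. 1 \<le> l \<Longrightarrow> k \<in> K \<Longrightarrow> frechet1 M (\<sigma> k) (\<lambda>\<omega>. R l \<omega> k)" "\<And>k. k \<in> K \<Longrightarrow> 0 < \<sigma> k"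
    and j: "\<And>l. 1 \<le> l \<Longrightarrow> 0 < j l" "j summable_on {1..}"
  shows "prob {\<omega> \<in> space M. \<forall>k\<in>K. first_argmax (\<lambda>l. j l * R l \<omega> k) = h k} =
    (\<Prod>k\<in>K. if h k = 0 then 0 else j (h k) / (\<Sum>\<^sub>\<infinity>l\<in>{1..}. j l))"
proof (cases "K = {}")
  case False
  define col where "col k \<omega> = (\<lambda>p\<in>{1..} \<times> {k}. (\<lambda>(l, k) \<omega>. R l \<omega> k) p \<omega>)" for k \<omega>
  define H where "H k c = first_argmax (\<lambda>l. j l * c (l, k))" for k and c :: "nat \<times> 'k \<Rightarrow> real"
  have ind: "indep_vars (\<lambda>_. borel) (\<lambda>(l, k) \<omega>. R l \<omega> k) ({1..} \<times> K)"
    using indep_vars_nested[OF rows cols \<open>finite K\<close>] by (simp add: split_beta')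
  have "indep_vars (\<lambda>k. Pi\<^sub>M ({1..} \<times> {k}) (\<lambda>_. borel)) col K"
    unfolding col_def using ind by (rule indep_vars_restrict) (auto simp: disjoint_family_on_def)
  then have indH: "indep_vars (\<lambda>_. count_space UNIV) (\<lambda>k \<omega>. H k (col k \<omega>)) K"
  proof (rule indep_vars_compose2)
    fix k assume "k \<in> K"
    show "H k \<in> measurable (Pi\<^sub>M ({1..} \<times> {k}) (\<lambda>_. borel)) (count_space UNIV)"
      unfolding H_def by (intro measurable_first_argmax borel_measurable_times
          borel_measurable_const measurable_component_singleton) auto
  qed
  have H: "H k (col k \<omega>) = first_argmax (\<lambda>l. j l * R l \<omega> k)" for k \<omega>
    unfolding H_def by (rule first_argmax_cong) (simp add: col_def)
  have "{\<omega> \<in> space M. \<forall>k\<in>K. first_argmax (\<lambda>l. j l * R l \<omega> k) = h k} =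
      (\<Inter>k\<in>K. (\<lambda>\<omega>. H k (col k \<omega>)) -` {h k} \<inter> space M)"
    using False by (auto simp: H)
  also have "prob \<dots> = (\<Prod>k\<in>K. prob ((\<lambda>\<omega>. H k (col k \<omega>)) -` {h k} \<inter> space M))"
    using False \<open>finite K\<close> by (intro indep_varsD_finite[OF indH]) auto
  also have "\<dots> = (\<Prod>k\<in>K. if h k = 0 then 0 else j (h k) / (\<Sum>\<^sub>\<infinity>l\<in>{1..}. j l))"
  proof (rule prod.cong[OF refl])
    fix k assume k: "k \<in> K"
    have "indep_vars (\<lambda>_. borel) (\<lambda>l \<omega>. R l \<omega> k) {1..}"
      by (rule indep_vars_compose2[OF rows]) (use k in simp)
    then have "prob {\<omega> \<in> space M. first_argmax (\<lambda>l. j l * R l \<omega> k) = h k} =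
        (if h k = 0 then 0 else j (h k) / (\<Sum>\<^sub>\<infinity>l\<in>{1..}. j l))"
      using R k j by (intro prob_first_argmax) auto
    moreover have "(\<lambda>\<omega>. H k (col k \<omega>)) -` {h k} \<inter> space M =
        {\<omega> \<in> space M. first_argmax (\<lambda>l. j l * R l \<omega> k) = h k}"
      by (auto simp: H)
    ultimately show "prob ((\<lambda>\<omega>. H k (col k \<omega>)) -` {h k} \<inter> space M) =
        (if h k = 0 then 0 else j (h k) / (\<Sum>\<^sub>\<infinity>l\<in>{1..}. j l))" by simp
  qed
  finally show ?thesis .
qed (simp add: prob_space)

section \<open>The conditional law of the hitting indices\<close>

lemma hitting_index_eq: "hitting_index J Y \<omega> k = first_argmax (\<lambda>l. J l \<omega> * Y l k \<omega>)"
  by (simp add: hitting_index_def first_argmax_def)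

text \<open>The library's \<open>indep_var\<close> only covers two variables with values in the same type.\<close>

lemma (in prob_space) joint_distr_of_indep_set:
  assumes [measurable]: "X \<in> measurable M S" "Y \<in> measurable M T"
    and indep: "indep_set (sets (vimage_algebra (space M) X S)) (sets (vimage_algebra (space M) Y T))"
  shows "distr M (S \<Otimes>\<^sub>M T) (\<lambda>\<omega>. (X \<omega>, Y \<omega>)) = distr M S X \<Otimes>\<^sub>M distr M T Y"
proof (rule pair_measure_eqI[symmetric])
  interpret X: prob_space "distr M S X" by (rule prob_space_distr) simp
  interpret Y: prob_space "distr M T Y" by (rule prob_space_distr) simp
  show "sigma_finite_measure (distr M S X)" "sigma_finite_measure (distr M T Y)"
    by unfold_locales
  fix A B assume "A \<in> sets (distr M S X)" "B \<in> sets (distr M T Y)"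
  then have [measurable]: "A \<in> sets S" "B \<in> sets T" by auto
  have "prob ((X -` A \<inter> space M) \<inter> (Y -` B \<inter> space M)) = prob (X -` A \<inter> space M) * prob (Y -` B \<inter> space M)"
    using indep by (rule indep_setD) (auto intro: in_vimage_algebra)
  moreover have "(\<lambda>\<omega>. (X \<omega>, Y \<omega>)) -` (A \<times> B) \<inter> space M = (X -` A \<inter> space M) \<inter> (Y -` B \<inter> space M)"
    by auto
  ultimately show "emeasure (distr M S X) A * emeasure (distr M T Y) B =
      emeasure (distr M (S \<Otimes>\<^sub>M T) (\<lambda>\<omega>. (X \<omega>, Y \<omega>))) (A \<times> B)"
    by (simp add: emeasure_distr emeasure_eq_measure ennreal_mult)
qed (simp cong: sets_pair_measure_cong)

lemma normalized_weights_nonneg: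
  assumes "\<And>l. 1 \<le> l \<Longrightarrow> 0 \<le> J l \<omega>"
  shows "0 \<le> normalized_weights J \<omega> l"
proof -
  have "0 \<le> (\<Sum>\<^sub>\<infinity>l\<in>{1..}. J l \<omega>)"
    using assms by (intro infsum_nonneg) auto
  then show ?thesis
    using assms unfolding normalized_weights_def by (simp only: divide_nonneg_nonneg split: if_split) simp
qed

lemma (in prob_space) emeasure_hitting_indices:
  assumes levy: "levy_type_measure \<nu>" and enum: "measurable_enumeration M \<nu> J"
    and iid: "iid_rows M n Y" and indep: "points_indep_rows M \<nu> n J Y"
    and cols: "\<And>l. l \<in> {1..} \<Longrightarrow> indep_vars (\<lambda>_. borel) (Y l) {1..n}"
    and frechet: "\<And>l k. l \<in> {1..} \<Longrightarrow> k \<in> {1..n} \<Longrightarrow> frechet1 M (\<sigma> k) (Y l k)"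
    and \<sigma>: "\<And>k. k \<in> {1..n} \<Longrightarrow> 0 < \<sigma> k"
  shows "emeasure M {\<omega> \<in> space M. \<forall>k\<in>{1..n}. hitting_index J Y \<omega> k = h k} =
    (\<integral>\<^sup>+\<omega>. (\<Prod>k\<in>{1..n}. ennreal (normalized_weights J \<omega> (h k))) \<partial>M)"
proof -
  define SJ where "SJ = Pi\<^sub>M {1::nat..} (\<lambda>_. \<nu>)"
  define SY where "SY = Pi\<^sub>M {1::nat..} (\<lambda>_. row_space n)"
  define JJ where "JJ \<omega> = (\<lambda>l\<in>{1..}. J l \<omega>)" for \<omega>
  define YY where "YY \<omega> = (\<lambda>l\<in>{1..}. row n Y l \<omega>)" for \<omega>
  define \<Phi> where "\<Phi> = {p \<in> space (SJ \<Otimes>\<^sub>M SY). \<forall>k\<in>{1..n}. first_argmax (\<lambda>l. fst p l * snd p l k) = h k}"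
  have J_meas: "J l \<in> measurable M \<nu>" if "1 \<le> l" for l
    using enum that by (auto simp: measurable_enumeration_def)
  have rows: "indep_vars (\<lambda>_. row_space n) (row n Y) {1..}"
    using iid by (simp add: iid_rows_def)
  have row_meas: "row n Y l \<in> measurable M (row_space n)" if "1 \<le> l" for l
    using rows that by (auto simp: indep_vars_def)
  have JJ [measurable]: "JJ \<in> measurable M SJ"
    unfolding JJ_def SJ_def using J_meas by (intro measurable_restrict) auto
  have YY [measurable]: "YY \<in> measurable M SY"
    unfolding YY_def SY_def using row_meas by (intro measurable_restrict) auto
  have joint: "distr M (SJ \<Otimes>\<^sub>M SY) (\<lambda>\<omega>. (JJ \<omega>, YY \<omega>)) = distr M SJ JJ \<Otimes>\<^sub>M distr M SY YY"
    using indep unfolding points_indep_rows_def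
    by (intro joint_distr_of_indep_set JJ YY) (simp add: JJ_def[abs_def] YY_def[abs_def] SJ_def SY_def)
  interpret DY: prob_space "distr M SY YY" by (rule prob_space_distr) simp
  have id_\<nu>: "(\<lambda>x. x) \<in> borel_measurable \<nu>"
    using levy by (subst measurable_cong_sets[of _ "restrict_space borel {0<..}"])
      (auto simp: levy_type_measure_def intro: measurable_restrict_space1)
  have \<Phi> [measurable]: "\<Phi> \<in> sets (SJ \<Otimes>\<^sub>M SY)"
  proof -
    have "(\<lambda>p. first_argmax (\<lambda>l. fst p l * snd p l k)) \<in> measurable (SJ \<Otimes>\<^sub>M SY) (count_space UNIV)"
      if "k \<in> {1..n}" for k
    proof (intro measurable_first_argmax borel_measurable_times)
      fix l :: nat assume l: "1 \<le> l"
      have "(\<lambda>j. j l) \<in> borel_measurable SJ"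
        unfolding SJ_def using l
        by (intro measurable_compose[where g="\<lambda>x. x", OF _ id_\<nu>] measurable_component_singleton) auto
      then show "(\<lambda>p. fst p l) \<in> borel_measurable (SJ \<Otimes>\<^sub>M SY)" by measurable
      have "(\<lambda>y. y l k) \<in> borel_measurable SY"
        unfolding SY_def using l that
        by (intro measurable_compose[where f="\<lambda>y. y l" and g="\<lambda>r. r k" and N="row_space n"]
            measurable_component_singleton) auto
      then show "(\<lambda>p. snd p l k) \<in> borel_measurable (SJ \<Otimes>\<^sub>M SY)" by measurable
    qed
    then have "{p \<in> space (SJ \<Otimes>\<^sub>M SY). first_argmax (\<lambda>l. fst p l * snd p l k) = h k} \<in> sets (SJ \<Otimes>\<^sub>M SY)"
      if "k \<in> {1..n}" for k
      using measurable_sets[of _ "SJ \<Otimes>\<^sub>M SY" "count_space UNIV" "{h k}"] that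
      by (simp add: vimage_def Int_def conj_commute)
    then show ?thesis
      unfolding \<Phi>_def by (intro sets.sets_Collect_finite_All) simp_all
  qed
  \<comment> \<open>Points and rows are read at separate outcomes. The diagonal case gives the event
    about the hitting indices; a fixed \<open>\<omega>\<close> with varying \<open>\<omega>'\<close>
    gives the section used by Fubini.\<close>
  have in_\<Phi>: "(JJ \<omega>, YY \<omega>') \<in> \<Phi> \<longleftrightarrow> (\<forall>k\<in>{1..n}. first_argmax (\<lambda>l. J l \<omega> * Y l k \<omega>') = h k)"
    if "\<omega> \<in> space M" "\<omega>' \<in> space M" for \<omega> \<omega>'
  proof -
    have "first_argmax (\<lambda>l. JJ \<omega> l * YY \<omega>' l k) = first_argmax (\<lambda>l. J l \<omega> * Y l k \<omega>')"
      if "k \<in> {1..n}" for k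
      using that by (intro first_argmax_cong) (auto simp: JJ_def YY_def row_def)
    then show ?thesis
      using measurable_space[OF JJ] measurable_space[OF YY] that
      by (auto simp: \<Phi>_def space_pair_measure)
  qed
  have conditional: "emeasure M {\<omega>' \<in> space M. \<forall>k\<in>{1..n}. first_argmax (\<lambda>l. J l \<omega> * Y l k \<omega>') = h k} =
      (\<Prod>k\<in>{1..n}. ennreal (normalized_weights J \<omega> (h k)))"
    if \<omega>: "\<omega> \<in> space M" and sm: "(\<lambda>l. J l \<omega>) summable_on {1..}" for \<omega>
  proof -
    have pos: "0 < J l \<omega>" if "1 \<le> l" for l
      using points_pos[OF levy enum that \<omega>] .
    have "prob {\<omega>' \<in> space M. \<forall>k\<in>{1..n}. first_argmax (\<lambda>l. J l \<omega> * row n Y l \<omega>' k) = h k} =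
      (\<Prod>k\<in>{1..n}. normalized_weights J \<omega> (h k))"
      unfolding normalized_weights_def
    proof (rule prob_first_argmax_columns[OF rows])
      fix l :: nat assume "1 \<le> l"
      then show "indep_vars (\<lambda>_. borel) (\<lambda>k \<omega>. row n Y l \<omega> k) {1..n}"
        by (intro indep_vars_cong[THEN iffD1, OF _ _ _ cols[of l]]) (auto simp: row_def)
      show "frechet1 M (\<sigma> k) (\<lambda>\<omega>. row n Y l \<omega> k)" if "k \<in> {1..n}" for k
        using frechet[of l k] that \<open>1 \<le> l\<close> by (simp add: row_def)
    qed (use \<sigma> pos sm in auto)
    moreover have "(\<forall>k\<in>{1..n}. first_argmax (\<lambda>l. J l \<omega> * row n Y l \<omega>' k) = h k) \<longleftrightarrow>
        (\<forall>k\<in>{1..n}. first_argmax (\<lambda>l. J l \<omega> * Y l k \<omega>') = h k)" for \<omega>'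
      by (simp add: row_def)
    moreover have "0 \<le> normalized_weights J \<omega> l" for l
      using pos by (intro normalized_weights_nonneg) (auto intro: less_imp_le)
    ultimately show ?thesis
      by (simp only: emeasure_eq_measure prod_ennreal)
  qed
  have "emeasure M {\<omega> \<in> space M. \<forall>k\<in>{1..n}. hitting_index J Y \<omega> k = h k} =
      emeasure (distr M (SJ \<Otimes>\<^sub>M SY) (\<lambda>\<omega>. (JJ \<omega>, YY \<omega>))) \<Phi>"
    by (subst emeasure_distr) (auto simp: in_\<Phi> hitting_index_eq intro!: arg_cong2[where f=emeasure])
  also have "\<dots> = (\<integral>\<^sup>+j. emeasure (distr M SY YY) (Pair j -` \<Phi>) \<partial>distr M SJ JJ)"
    unfolding joint by (rule DY.emeasure_pair_measure_alt) simp
  also have "\<dots> = (\<integral>\<^sup>+\<omega>. emeasure (distr M SY YY) (Pair (JJ \<omega>) -` \<Phi>) \<partial>M)"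
    by (rule nn_integral_distr[OF JJ]) (use DY.measurable_emeasure_Pair[of \<Phi> SJ] in simp)
  also have "\<dots> = (\<integral>\<^sup>+\<omega>. (\<Prod>k\<in>{1..n}. ennreal (normalized_weights J \<omega> (h k))) \<partial>M)"
  \<comment> \<open>The formula \<open>conditional\<close> concerns summable points, so the
    integrands are compared almost everywhere.\<close>
  proof (rule nn_integral_cong_AE, use AE_points_summable[OF levy enum] in \<open>rule AE_mp\<close>, intro AE_I2 impI)
    fix \<omega> assume \<omega>: "\<omega> \<in> space M" "(\<lambda>l. J l \<omega>) summable_on {1..}"
    have "emeasure (distr M SY YY) (Pair (JJ \<omega>) -` \<Phi>) =
        emeasure M {\<omega>' \<in> space M. \<forall>k\<in>{1..n}. first_argmax (\<lambda>l. J l \<omega> * Y l k \<omega>') = h k}"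
      using \<omega>(1) by (subst emeasure_distr) (auto simp: in_\<Phi> intro!: arg_cong2[where f=emeasure] sets_Pair1)
    then show "emeasure (distr M SY YY) (Pair (JJ \<omega>) -` \<Phi>) =
        (\<Prod>k\<in>{1..n}. ennreal (normalized_weights J \<omega> (h k)))"
      using conditional[OF \<omega>] by simp
  qed
  finally show ?thesis .
qed

section \<open>Paintbox partitions\<close>

abbreviation labellings :: "nat \<Rightarrow> (nat \<Rightarrow> nat) set" where
  "labellings n \<equiv> {1..n} \<rightarrow>\<^sub>E UNIV"

lemma countable_labellings: "countable (labellings n)"
  by (intro countable_PiE) auto

text \<open>A finite product of countable discrete spaces is discrete, so laws of labellings can be
  compared on singletons.\<close>

lemma sets_iid_sample: "sets (iid_sample n s) = Pow (labellings n)"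
proof -
  have "sets (iid_sample n s) = sets (Pi\<^sub>M {1..n} (\<lambda>_. count_space UNIV))"
    unfolding iid_sample_def by (rule sets_PiM_cong) auto
  then show ?thesis by (subst (asm) count_space_PiM_finite) auto
qed

lemma emeasure_iid_sample_PiE:
  "emeasure (iid_sample n s) (Pi\<^sub>E {1..n} A) =
    (\<Prod>k\<in>{1..n}. \<integral>\<^sup>+l. ennreal (s l) * indicator (A k) l \<partial>count_space UNIV)"
proof -
  interpret sigma_finite_measure "count_space (UNIV :: nat set)"
    by (rule sigma_finite_measure_count_space)
  interpret product_sigma_finite "\<lambda>_::nat. density (count_space UNIV) (\<lambda>l::nat. ennreal (s l))"
    \<comment> \<open>Real weights give a finite density at each label, so every factor is
      sigma-finite whether or not the weights are summable.\<close>
    by (intro product_sigma_finite.intro) (simp add: sigma_finite_iff_density_finite)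
  show ?thesis
    unfolding iid_sample_def by (subst emeasure_PiM) (auto simp: emeasure_density)
qed

lemma emeasure_iid_sample_singleton:
  assumes "h \<in> labellings n"
  shows "emeasure (iid_sample n s) {h} = (\<Prod>k\<in>{1..n}. ennreal (s (h k)))"
proof -
  have "{h} = Pi\<^sub>E {1..n} (\<lambda>k. {h k})"
    using assms by (intro PiE_singleton[symmetric]) (auto simp: PiE_def)
  then have "emeasure (iid_sample n s) {h} = emeasure (iid_sample n s) (Pi\<^sub>E {1..n} (\<lambda>k. {h k}))"
    by simp
  also have "\<dots> = (\<Prod>k\<in>{1..n}. ennreal (s (h k)))"
    unfolding emeasure_iid_sample_PiE by simp
  finally show ?thesis .
qed

text \<open>On a singleton the sample measure is a product of weights, hence measurable in
  \<open>\<omega>\<close>. By countability the singletons generate all sets, and adding the empty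
  set makes them stable under intersection. The total mass is treated separately because the
  generator need not contain the whole space.\<close>

lemma measurable_iid_sample:
  assumes [measurable]: "\<And>l. (\<lambda>\<omega>. s \<omega> l) \<in> borel_measurable M"
    and sub: "\<And>\<omega>. \<omega> \<in> space M \<Longrightarrow> (\<Sum>l. ennreal (s \<omega> l)) \<le> 1"
  shows "(\<lambda>\<omega>. iid_sample n (s \<omega>)) \<in> measurable M (subprob_algebra (count_space (labellings n)))"
proof (rule measurable_subprob_algebra_generated)
  have total: "emeasure (iid_sample n (s \<omega>)) (labellings n) = (\<Prod>k\<in>{1..n}. \<Sum>l. ennreal (s \<omega> l))" for \<omega>
    unfolding emeasure_iid_sample_PiE by (simp add: nn_integral_count_space_nat)
  show "sets (count_space (labellings n)) = sigma_sets (labellings n) (insert {} ((\<lambda>h. {h}) ` labellings n))"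
    unfolding sets_count_space sigma_sets_singletons[OF countable_labellings, symmetric]
    by (rule sigma_sets_eqI) (auto intro: sigma_sets.intros)
  show "Int_stable (insert {} ((\<lambda>h. {h}) ` labellings n))"
    by (auto simp: Int_stable_def)
  show "subprob_space (iid_sample n (s \<omega>))" if "\<omega> \<in> space M" for \<omega>
  proof (rule subprob_spaceI)
    have sp: "space (iid_sample n (s \<omega>)) = labellings n"
      by (simp add: iid_sample_def space_PiM)
    have "(\<Prod>k\<in>{1..n}. \<Sum>l. ennreal (s \<omega> l)) \<le> (\<Prod>k\<in>{1..n}. 1)"
      using sub[OF that] by (intro prod_mono_ennreal)
    then show "emeasure (iid_sample n (s \<omega>)) (space (iid_sample n (s \<omega>))) \<le> 1"
      unfolding sp total by simp
    show "space (iid_sample n (s \<omega>)) \<noteq> {}" by (simp add: sp PiE_eq_empty_iff)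
  qed
  show "(\<lambda>\<omega>. emeasure (iid_sample n (s \<omega>)) A) \<in> borel_measurable M"
    if "A \<in> insert {} ((\<lambda>h. {h}) ` labellings n)" for A
    using that by (auto simp: emeasure_iid_sample_singleton)
  show "(\<lambda>\<omega>. emeasure (iid_sample n (s \<omega>)) (labellings n)) \<in> borel_measurable M"
    unfolding total by measurable
qed (auto simp: sets_iid_sample)

lemma partition_on_paintbox_partition: "partition_on {1..n} (paintbox_partition n h)"
  unfolding paintbox_partition_def
  by (rule partition_on_quotient) (auto intro!: equivI refl_onI symI transI)

text \<open>Any labelling \<open>X\<close> with the averaged sampling probabilities represents the
  paintbox. The mixture of sample laws and the law of \<open>X\<close> agree on singletons of a
  countable space, and forming the partition commutes with \<open>bind\<close>.\<close>

lemma paintbox_law_eq: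
  assumes M: "space M \<noteq> {}"
    and s: "\<And>l. (\<lambda>\<omega>. s \<omega> l) \<in> borel_measurable M"
      "\<And>\<omega>. \<omega> \<in> space M \<Longrightarrow> (\<Sum>l. ennreal (s \<omega> l)) \<le> 1"
    and X: "X \<in> measurable M (count_space (labellings n))"
    and law: "\<And>h. h \<in> labellings n \<Longrightarrow> emeasure M {\<omega> \<in> space M. X \<omega> = h} =
      (\<integral>\<^sup>+\<omega>. (\<Prod>k\<in>{1..n}. ennreal (s \<omega> (h k))) \<partial>M)"
  shows "paintbox_law M n s = distr M (partition_space n) (\<lambda>\<omega>. paintbox_partition n (X \<omega>))"
proof -
  define K where "K \<omega> = iid_sample n (s \<omega>)" for \<omega>
  have K [measurable]: "K \<in> measurable M (subprob_algebra (count_space (labellings n)))"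
    unfolding K_def by (rule measurable_iid_sample) (fact s)+
  have paint: "paintbox_partition n \<in> measurable (count_space (labellings n)) (partition_space n)"
    unfolding partition_space_def using partition_on_paintbox_partition by auto
  have "M \<bind> K = distr M (count_space (labellings n)) X"
  proof (rule measure_eqI_countable[OF _ _ countable_labellings])
    show "sets (M \<bind> K) = Pow (labellings n)"
      using M by (subst sets_bind[of _ _ "count_space (labellings n)"]) (auto simp: K_def sets_iid_sample)
    fix h assume h: "h \<in> labellings n"
    then have "emeasure (M \<bind> K) {h} = (\<integral>\<^sup>+\<omega>. (\<Prod>k\<in>{1..n}. ennreal (s \<omega> (h k))) \<partial>M)"
      by (subst emeasure_bind[OF M K]) (auto simp: K_def emeasure_iid_sample_singleton)
    also have "\<dots> = emeasure (distr M (count_space (labellings n)) X) {h}"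
      unfolding law[OF h, symmetric] using h X
      by (subst emeasure_distr) (auto intro!: arg_cong2[where f=emeasure])
    finally show "emeasure (M \<bind> K) {h} = emeasure (distr M (count_space (labellings n)) X) {h}" .
  qed simp
  then have "distr (M \<bind> K) (partition_space n) (paintbox_partition n) =
      distr M (partition_space n) (\<lambda>\<omega>. paintbox_partition n (X \<omega>))"
    using X paint by (simp add: distr_distr comp_def)
  then show ?thesis
    by (simp add: paintbox_law_def distr_bind[OF K M paint] K_def)
qed

lemma paintbox_partition_eq:
  "paintbox_partition n h = (\<lambda>i. {j \<in> {1..n}. i = j \<or> h i = h j \<and> h i > 0}) ` {1..n}"
  unfolding paintbox_partition_def quotient_def UNION_singleton_eq_range
  by (intro image_cong refl) auto

lemma paintbox_partition_cong:
  assumes "\<And>k. k \<in> {1..n} \<Longrightarrow> h k = g k"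
  shows "paintbox_partition n h = paintbox_partition n g"
  unfolding paintbox_partition_eq using assms by (intro image_cong Collect_cong) auto

text \<open>Elements \<open>i\<close> and \<open>j\<close> share a block under
  \<open>h \<circ> p\<close> exactly when \<open>p i\<close> and \<open>p j\<close> share one under
  \<open>h\<close>. Injectivity of \<open>p\<close> handles the clause \<open>i = j\<close>.\<close>

lemma permute_paintbox_partition:
  assumes p: "p permutes {1..n}"
  shows "permute_partition p (paintbox_partition n (h \<circ> p)) = paintbox_partition n h"
proof -
  have "p ` {j \<in> {1..n}. i = j \<or> h (p i) = h (p j) \<and> h (p i) > 0} =
      {j \<in> {1..n}. p i = j \<or> h (p i) = h j \<and> h (p i) > 0}" for i
  proof -
    have "p ` {j \<in> {1..n}. i = j \<or> h (p i) = h (p j) \<and> h (p i) > 0} =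
        p ` {j \<in> {1..n}. p i = p j \<or> h (p i) = h (p j) \<and> h (p i) > 0}"
      by (simp only: inj_eq[OF permutes_inj[OF p]])
    also have "\<dots> = {j \<in> p ` {1..n}. p i = j \<or> h (p i) = h j \<and> h (p i) > 0}"
      by blast
    finally show ?thesis by (simp only: permutes_image[OF p])
  qed
  then have "permute_partition p (paintbox_partition n (h \<circ> p)) =
      (\<lambda>i. {j \<in> {1..n}. p i = j \<or> h (p i) = h j \<and> h (p i) > 0}) ` {1..n}"
    unfolding permute_partition_def paintbox_partition_eq image_image comp_def by (intro image_cong refl)
  also have "\<dots> = (\<lambda>i. {j \<in> {1..n}. i = j \<or> h i = h j \<and> h i > 0}) ` p ` {1..n}"
    by (simp only: image_image)
  also have "\<dots> = paintbox_partition n h"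
    by (simp only: permutes_image[OF p] paintbox_partition_eq)
  finally show ?thesis .
qed

lemma partition_on_permute_partition:
  assumes P: "partition_on {1..n} P" and p: "p permutes {1..n}"
  shows "partition_on {1..n} (permute_partition p P)"
proof -
  have "{} \<notin> (`) p ` P"
    using P by (auto simp: partition_on_def)
  then show ?thesis
    using partition_on_inj_image[OF P permutes_inj_on[OF p]]
    unfolding permutes_image[OF p] permute_partition_def by simp
qed

section \<open>Measurability and total mass of the weights\<close>

text \<open>The right side is measurable in the terms by standard closure rules. The identity
  extends to divergent series because \<open>infsum\<close> defaults to 0 and
  \<open>enn2real\<close> sends infinity to 0.\<close>

lemma infsum_eq_enn2real_suminf:
  fixes f :: "nat \<Rightarrow> real"
  assumes "\<And>l. 1 \<le> l \<Longrightarrow> 0 \<le> f l"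
  shows "(\<Sum>\<^sub>\<infinity>l\<in>{1..}. f l) = enn2real (\<Sum>l. ennreal (f (Suc l)))"
proof (cases "f summable_on {1..}")
  case True
  then have "(\<lambda>l. f (Suc l)) sums (\<Sum>\<^sub>\<infinity>l\<in>{1..}. f l)"
    by (rule sums_Suc_infsum)
  then have "(\<Sum>l. ennreal (f (Suc l))) = ennreal (\<Sum>\<^sub>\<infinity>l\<in>{1..}. f l)"
    using assms by (intro suminf_ennreal_eq) auto
  moreover have "0 \<le> (\<Sum>\<^sub>\<infinity>l\<in>{1..}. f l)"
    using assms by (intro infsum_nonneg) auto
  ultimately show ?thesis by simp
next
  case False
  have "(\<Sum>l. ennreal (f (Suc l))) = \<top>"
  proof (rule ccontr)
    assume "(\<Sum>l. ennreal (f (Suc l))) \<noteq> \<top>"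
    then have "summable (\<lambda>l. f (Suc l))"
      using assms by (intro summable_suminf_not_top) auto
    then have "(\<lambda>l. f (Suc l)) summable_on UNIV"
      using assms by (subst summable_on_UNIV_nonneg_real_iff) auto
    then show False
      using False unfolding summable_on_def has_sum_Suc_iff by simp
  qed
  then show ?thesis using False by (simp add: infsum_not_exists)
qed

lemma measurable_normalized_weights:
  assumes J: "\<And>l. 1 \<le> l \<Longrightarrow> J l \<in> borel_measurable M"
    and pos: "\<And>l \<omega>. 1 \<le> l \<Longrightarrow> \<omega> \<in> space M \<Longrightarrow> 0 \<le> J l \<omega>"
  shows "(\<lambda>\<omega>. normalized_weights J \<omega> l) \<in> borel_measurable M"
proof -
  have [measurable]: "J (Suc l) \<in> borel_measurable M" for l using J by simp
  have "(\<lambda>\<omega>. \<Sum>\<^sub>\<infinity>l\<in>{1..}. J l \<omega>) \<in> borel_measurable M"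
    using pos by (subst measurable_cong[OF infsum_eq_enn2real_suminf]) auto
  then show ?thesis
    unfolding normalized_weights_def using J[of l] by (cases "l = 0") auto
qed

text \<open>The sampling kernel requires this bound at every outcome. If the denominator is 0, which
  includes the divergent case, division by zero makes all weights vanish; otherwise they sum to
  1.\<close>

lemma suminf_normalized_weights_le_1:
  assumes pos: "\<And>l. 1 \<le> l \<Longrightarrow> 0 \<le> J l \<omega>"
  shows "(\<Sum>l. ennreal (normalized_weights J \<omega> l)) \<le> 1"
proof (cases "(\<Sum>\<^sub>\<infinity>l\<in>{1..}. J l \<omega>) = 0")
  case True
  then have "normalized_weights J \<omega> l = 0" for l
    by (simp add: normalized_weights_def)
  then show ?thesis by simp
next
  case False
  define S where "S = (\<Sum>\<^sub>\<infinity>l\<in>{1..}. J l \<omega>)"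
  have "0 \<le> S" unfolding S_def using pos by (intro infsum_nonneg) auto
  then have "0 < S" using False by (simp add: S_def)
  have "(\<lambda>l. J l \<omega>) summable_on {1..}"
    using False infsum_not_exists by blast
  then have "(\<lambda>l. J (Suc l) \<omega>) sums S"
    unfolding S_def by (rule sums_Suc_infsum)
  then have "(\<lambda>l. normalized_weights J \<omega> (Suc l)) sums 1"
    using sums_divide[of "\<lambda>l. J (Suc l) \<omega>" S S] \<open>0 < S\<close> by (simp add: normalized_weights_def S_def)
  then have "normalized_weights J \<omega> sums 1"
    by (subst (asm) sums_Suc_iff) (simp add: normalized_weights_def)
  then have "(\<Sum>l. ennreal (normalized_weights J \<omega> l)) = ennreal 1"
    by (intro suminf_ennreal_eq normalized_weights_nonneg pos)
  then show ?thesis by simp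
qed

section \<open>The law of the hitting partition\<close>

theorem theorem2p3:
  fixes M :: "'a measure" and \<nu> :: "real measure" and n :: nat and \<sigma> :: "nat \<Rightarrow> real"
    and J :: "nat \<Rightarrow> 'a \<Rightarrow> real" and Y :: "nat \<Rightarrow> nat \<Rightarrow> 'a \<Rightarrow> real"
  assumes "prob_space M"
    and "levy_type_measure \<nu>"
    and "n \<ge> 1"
    and "\<And>k. k \<in> {1..n} \<Longrightarrow> \<sigma> k > 0"
    and "measurable_enumeration M \<nu> J"
    and "iid_rows M n Y"
    and "points_indep_rows M \<nu> n J Y"
    and "\<And>l. l \<in> {1..} \<Longrightarrow> prob_space.indep_vars M (\<lambda>_. borel) (Y l) {1..n}"
    and "\<And>l k. l \<in> {1..} \<Longrightarrow> k \<in> {1..n} \<Longrightarrow> frechet1 M (\<sigma> k) (Y l k)"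
  shows "exchangeable_random_partition M n (hitting_partition n J Y) \<and>
    distr M (partition_space n) (hitting_partition n J Y) =
      paintbox_law M n (normalized_weights J)"
proof -
  interpret prob_space M by fact
  define hit where "hit \<omega> = (\<lambda>k\<in>{1..n}. hitting_index J Y \<omega> k)" for \<omega>
  define w where "w = normalized_weights J"
  have J_pos: "0 < J l \<omega>" if "1 \<le> l" "\<omega> \<in> space M" for l \<omega>
    using points_pos[OF assms(2,5) that] .
  have J_meas: "J l \<in> borel_measurable M" if "1 \<le> l" for l
  proof -
    have "J l \<in> measurable M (restrict_space borel {0<..})"
      using assms(2,5) that
      by (subst measurable_cong_sets[of M M _ \<nu>]) (auto simp: levy_type_measure_def measurable_enumeration_def)
    then show ?thesis by (simp add: measurable_restrict_space2_iff)
  qed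
  have hitting_index_meas: "(\<lambda>\<omega>. hitting_index J Y \<omega> k) \<in> measurable M (count_space UNIV)" if "k \<in> {1..n}" for k
    unfolding hitting_index_eq
    using J_meas assms(9) that
    by (intro measurable_first_argmax borel_measurable_times) (auto simp: frechet1_def)
  have labelling_meas: "(\<lambda>\<omega>. \<lambda>k\<in>{1..n}. hit \<omega> (q k)) \<in> measurable M (count_space (labellings n))"
    if q: "q permutes {1..n}" for q
  proof -
    have "(\<lambda>\<omega>. \<lambda>k\<in>{1..n}. hit \<omega> (q k)) \<in> measurable M (Pi\<^sub>M {1..n} (\<lambda>_. count_space UNIV))"
      using hitting_index_meas permutes_in_image[OF q]
      by (intro measurable_restrict) (simp add: hit_def)
    then show ?thesis by (subst (asm) count_space_PiM_finite) auto
  qed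
  have hit_meas: "hit \<in> measurable M (count_space (labellings n))"
    using labelling_meas[OF permutes_id] by (simp add: hit_def[abs_def] cong: restrict_cong)
  have hit_law: "emeasure M {\<omega> \<in> space M. \<forall>k\<in>{1..n}. hit \<omega> k = h k} =
      (\<integral>\<^sup>+\<omega>. (\<Prod>k\<in>{1..n}. ennreal (w \<omega> (h k))) \<partial>M)" for h
  proof -
    have "(\<forall>k\<in>{1..n}. hit \<omega> k = h k) \<longleftrightarrow> (\<forall>k\<in>{1..n}. hitting_index J Y \<omega> k = h k)" for \<omega>
      by (simp add: hit_def)
    then show ?thesis
      unfolding w_def using emeasure_hitting_indices[OF assms(2,5,6,7,8,9,4), of h] by (simp only:)
  qed
  \<comment> \<open>The reordering \<open>q\<close> is kept arbitrary: the identity yields the law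
    of the hitting partition and \<open>inv p\<close> yields its invariance under
    \<open>p\<close>.\<close>
  have paint_law: "paintbox_law M n w =
      distr M (partition_space n) (\<lambda>\<omega>. paintbox_partition n (\<lambda>k\<in>{1..n}. hit \<omega> (q k)))"
    if q: "q permutes {1..n}" for q
  proof (rule paintbox_law_eq[OF not_empty _ _ labelling_meas[OF q]])
    show "(\<lambda>\<omega>. w \<omega> l) \<in> borel_measurable M" for l
      unfolding w_def using J_meas J_pos by (intro measurable_normalized_weights) (auto intro: less_imp_le)
    show "(\<Sum>l. ennreal (w \<omega> l)) \<le> 1" if "\<omega> \<in> space M" for \<omega>
      unfolding w_def using J_pos that by (intro suminf_normalized_weights_le_1) (auto intro: less_imp_le)
    fix h assume h: "h \<in> labellings n"
    have "(\<lambda>k\<in>{1..n}. x (q k)) = h \<longleftrightarrow> (\<forall>k\<in>{1..n}. x k = h (inv q k))" for x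
    proof -
      have "(\<lambda>k\<in>{1..n}. x (q k)) = h \<longleftrightarrow> (\<forall>k\<in>{1..n}. x (q k) = h k)"
        using h by (auto simp: fun_eq_iff PiE_def extensional_def)
      also have "\<dots> \<longleftrightarrow> (\<forall>k\<in>q ` {1..n}. x k = h (inv q k))"
        by (simp add: permutes_inverses[OF q])
      finally show ?thesis by (simp only: permutes_image[OF q])
    qed
    then have "emeasure M {\<omega> \<in> space M. (\<lambda>k\<in>{1..n}. hit \<omega> (q k)) = h} =
        (\<integral>\<^sup>+\<omega>. (\<Prod>k\<in>{1..n}. ennreal (w \<omega> (h (inv q k)))) \<partial>M)"
      by (simp only: hit_law)
    also have "\<dots> = (\<integral>\<^sup>+\<omega>. (\<Prod>k\<in>{1..n}. ennreal (w \<omega> (h k))) \<partial>M)"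
      using prod.permute[OF permutes_inv[OF q], of "\<lambda>k. ennreal (w _ (h k))"]
      by (simp only: comp_def)
    finally show "emeasure M {\<omega> \<in> space M. (\<lambda>k\<in>{1..n}. hit \<omega> (q k)) = h} =
        (\<integral>\<^sup>+\<omega>. (\<Prod>k\<in>{1..n}. ennreal (w \<omega> (h k))) \<partial>M)" .
  qed
  \<comment> \<open>Each labelling that uses label 0 has probability 0 since its product of weights
    has a zero factor, and there are only countably many labellings.\<close>
  have "AE \<omega> in M. \<forall>h\<in>{h \<in> labellings n. \<exists>k\<in>{1..n}. h k = 0}. hit \<omega> \<noteq> h"
  proof (rule AE_ball_countable')
    show "countable {h \<in> labellings n. \<exists>k\<in>{1..n}. h k = 0}"
      by (rule countable_subset[OF _ countable_labellings]) auto
    fix h assume "h \<in> {h \<in> labellings n. \<exists>k\<in>{1..n}. h k = 0}"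
    then obtain i where h: "h \<in> labellings n" and i: "i \<in> {1..n}" "h i = 0" by blast
    have "(\<Prod>k\<in>{1..n}. ennreal (w \<omega> (h k))) = 0" for \<omega>
      using i by (intro prod_zero bexI[of _ i]) (auto simp: w_def normalized_weights_def)
    then have "emeasure M {\<omega> \<in> space M. \<forall>k\<in>{1..n}. hit \<omega> k = h k} = 0"
      unfolding hit_law by (simp only: nn_integral_0_iff_AE nn_integral_const mult_zero_left)
    moreover have "hit \<omega> = h \<longleftrightarrow> (\<forall>k\<in>{1..n}. hit \<omega> k = h k)" for \<omega>
      using h by (auto simp: hit_def fun_eq_iff PiE_def extensional_def)
    moreover have "{\<omega> \<in> space M. hit \<omega> = h} \<in> events"
      using measurable_sets[OF hit_meas, of "{h}"] h by (simp add: vimage_def Int_def conj_commute)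
    ultimately show "AE \<omega> in M. hit \<omega> \<noteq> h"
      by (subst AE_iff_measurable[of "{\<omega> \<in> space M. hit \<omega> = h}"]) auto
  qed
  then have hit_pos: "AE \<omega> in M. \<forall>k\<in>{1..n}. 0 < hit \<omega> k"
  proof eventually_elim
    case (elim \<omega>)
    have "hit \<omega> \<in> labellings n" by (simp add: hit_def)
    with elim show ?case by (auto simp del: neq0_conv simp: neq0_conv[symmetric])
  qed
  have hitting_eq_paintbox: "AE \<omega> in M. hitting_partition n J Y \<omega> = paintbox_partition n (hit \<omega>)"
    using hit_pos
  proof eventually_elim
    case (elim \<omega>)
    then have "{(i, j). i \<in> {1..n} \<and> j \<in> {1..n} \<and> hitting_index J Y \<omega> i = hitting_index J Y \<omega> j} =
        {(i, j). i \<in> {1..n} \<and> j \<in> {1..n} \<and> (i = j \<or> hit \<omega> i = hit \<omega> j \<and> 0 < hit \<omega> i)}"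
      by (auto simp: hit_def)
    then show ?case by (simp only: hitting_partition_def paintbox_partition_def)
  qed
  have hitting_meas: "hitting_partition n J Y \<in> measurable M (partition_space n)"
  proof -
    \<comment> \<open>Almost sure equality with the paintbox partition would not give measurability,
      as \<open>M\<close> may be incomplete. The hitting partition is therefore factored through the
      discrete space of labellings.\<close>
    define f where "f h = {1..n} // {(i, j). i \<in> {1..n} \<and> j \<in> {1..n} \<and> h i = (h j :: nat)}" for h
    have "partition_on {1..n} (f h)" for h
      unfolding f_def by (rule partition_on_quotient) (auto intro!: equivI refl_onI symI transI)
    then have "f \<in> measurable (count_space (labellings n)) (partition_space n)"
      unfolding partition_space_def by auto
    then have "(\<lambda>\<omega>. f (hit \<omega>)) \<in> measurable M (partition_space n)"
      by (rule measurable_compose[OF hit_meas])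
    moreover have "f (hit \<omega>) = hitting_partition n J Y \<omega>" for \<omega>
      unfolding f_def hitting_partition_def by (intro arg_cong2[where f=quotient]) (auto simp: hit_def)
    ultimately show ?thesis by simp
  qed
  have paint_meas: "paintbox_partition n \<in> measurable (count_space (labellings n)) (partition_space n)"
    unfolding partition_space_def using partition_on_paintbox_partition by auto
  have law: "distr M (partition_space n) (hitting_partition n J Y) = paintbox_law M n w"
  proof -
    have "(\<lambda>k\<in>{1..n}. hit \<omega> (id k)) = hit \<omega>" for \<omega>
      by (auto simp: hit_def fun_eq_iff)
    then have "paintbox_law M n w = distr M (partition_space n) (\<lambda>\<omega>. paintbox_partition n (hit \<omega>))"
      using paint_law[OF permutes_id] by simp
    also have "\<dots> = distr M (partition_space n) (hitting_partition n J Y)"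
      using hitting_eq_paintbox hitting_meas measurable_compose[OF hit_meas paint_meas]
      by (intro distr_cong_AE) (auto elim!: eventually_mono)
    finally show ?thesis by simp
  qed
  have "exchangeable_random_partition M n (hitting_partition n J Y)"
    unfolding exchangeable_random_partition_def
  proof (intro conjI allI impI hitting_meas)
    fix p assume p: "p permutes {1..n}"
    \<comment> \<open>After relabelling, the element \<open>p i\<close> carries the label that
      \<open>i\<close> had, which is why \<open>inv p\<close> appears.\<close>
    have permute_eq: "permute_partition p (paintbox_partition n (hit \<omega>)) =
        paintbox_partition n (\<lambda>k\<in>{1..n}. hit \<omega> (inv p k))" for \<omega>
    proof -
      have "paintbox_partition n (hit \<omega>) = paintbox_partition n ((\<lambda>k\<in>{1..n}. hit \<omega> (inv p k)) \<circ> p)"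
        using permutes_in_image[OF p] by (intro paintbox_partition_cong) (auto simp: permutes_inverses[OF p])
      then show ?thesis by (simp only: permute_paintbox_partition[OF p])
    qed
    have "permute_partition p \<in> measurable (partition_space n) (partition_space n)"
      unfolding partition_space_def using partition_on_permute_partition[OF _ p] by auto
    then have "distr M (partition_space n) (\<lambda>\<omega>. permute_partition p (hitting_partition n J Y \<omega>)) =
        distr M (partition_space n) (\<lambda>\<omega>. paintbox_partition n (\<lambda>k\<in>{1..n}. hit \<omega> (inv p k)))"
      using hitting_eq_paintbox
      by (intro distr_cong_AE refl measurable_compose[OF hitting_meas]
          measurable_compose[OF labelling_meas[OF permutes_inv[OF p]] paint_meas])
        (auto elim!: eventually_mono simp: permute_eq)
    then show "distr M (partition_space n) (\<lambda>\<omega>. permute_partition p (hitting_partition n J Y \<omega>)) =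
        distr M (partition_space n) (hitting_partition n J Y)"
      using law paint_law[OF permutes_inv[OF p]] by simp
  qed
  with law show ?thesis by (simp add: w_def)
qed

end
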